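(* Let $0<q,\mu,y<1$, let $s\ge 1$ and let $d_1,\ldots,d_s\in\mathbb{Z}_{\ge 0}$ with $d_1\ge 1$, $d_s\ge 1$. The total excess of the second class particles $$\Delta\rho_{\rm tot}:=\sum_{r=-\infty}^{\infty}(\rho(r)-\rho)=\sum_{r=1}^s(\rho_{\rm I}(r)-\rho)+\sum_{r>s}(\rho_{\rm II}(r)-\rho)$$ is given by $$\Delta\rho_{\rm tot}=-(d_1+\cdots+d_s).$$
   Context: Notation: $(z)_m=\prod_{j=0}^{m-1}(1-zq^j)$ for $m\in\mathbb{Z}_{\ge0}\cup\{\infty\}$; $g_m=\frac{(\mu)_m}{(q)_m}$. $q$-bosons: $F=\bigoplus_{m\ge0}\mathbb{C}|m\rangle$ with operators $\mathbf b|m\rangle=|m+1\rangle$, $\mathbf c|m\rangle=(1-q^m)|m-1\rangle$, $\mathbf k|m\rangle=q^m|m\rangle$ (with $|-1\rangle=0$). They satisfy $\mathbf k\mathbf b=q\mathbf b\mathbf k$, $\mathbf k\mathbf c=q^{-1}\mathbf c\mathbf k$, $\mathbf b\mathbf c=1-\mathbf k$, $\mathbf c\mathbf b=1-q\mathbf k$. The algebra $\mathcal B$ they generate has basis $\mathbf b^{\max(t,0)}\mathbf k^{u}\mathbf c^{\max(-t,0)}$ ($u\in\mathbb{Z}_{\ge0}$, $t\in\mathbb{Z}$). For $Q\in\mathcal B$, $Q'$ denotes its projection onto the span of $\{\mathbf k^u: u\ge1\}$, and $\mathrm{Tr}(\mathbf k^u)=(1-q^u)^{-1}$ for $u\ge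 1$. Matrix product operators: with $\frac{(\mu\mathbf b)_\infty}{(\mathbf b)_\infty}=\sum_{j\ge0}g_j\mathbf b^j$, $$X_{a,n}=\frac{(\mu)_{a+n}}{(q)_a(q)_n}\frac{(\mu\mathbf b)_\infty}{(\mathbf b)_\infty}\mathbf k^n\mathbf c^a,\qquad A_a=\sum_{n\ge0}X_{a,n}y^n\qquad(a,n\in\mathbb{Z}_{\ge0}).$$ For a product $Q$ of such operators, $\mathrm{Tr}(Q)'$ means $\mathrm{Tr}(Q')$ computed termwise in the expansion in powers of $y$ coming from the $A_a$'s (for each power of $y$ only finitely many terms have equally many $\mathbf b$'s and $\mathbf c$'s, and these give a polynomial in $\mathbf k$). Conditional probabilities (of finding $n$ second class particles at site $r$, given $d_i$ first class particles at site $i$ for $1\le i\le s$ and none elsewhere), with $Z_L=\mathrm{Tr}(A_{d_1}\cdots A_{d_s}A_0^{L-s})'$: \begin{align*} P_{\rm I}(r,n)&=\lim_{L\to\infty}Z_L^{-1}y^n\,\mathrm{Tr}(A_{d_1}\cdots A_{d_{r-1}}X_{d_r,n}A_{d_{r+1}}\cdots A_{d_s}A_0^{L-s})'\quad(1\le r\le s),\\ P_{\rm II}(r,n)&=\lim_{L\to\infty}Z_L^{-1}y^n\,\mathrm{Tr}(A_{d_1}\cdots A_{d_s}A_0^{r-s-1}X_{0,n}A_0^{L-r})'\quad(r>s),\\ P_{\rm III}(r,n)&=\lim_{L\to\infty}Z_L^{-1}y^n\,\mathrm{Tr}(X_{0,n}A_0^{|r|}A_{d_1}\cdots A_{d_s}A_0^{L-|r|-s-1})'\quad(r\le0).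 \end{align*} Local density: $\rho(r)=\sum_{n\ge0}nP(r,n)$, where $P=P_{\rm I},P_{\rm II},P_{\rm III}$ (and accordingly $\rho(r)=\rho_{\rm I}(r),\rho_{\rm II}(r),\rho_{\rm III}(r)$) for $1\le r\le s$, $r>s$, $r\le 0$ respectively. For $r\le0$ one has $\rho_{\rm III}(r)=\rho$. Average density: $\rho=\sum_{i\ge0}\frac{(1-\mu)yq^i}{(1-yq^i)(1-\mu yq^i)}$. *)

theory Defs
  imports "HOL-Analysis.Analysis" "HOL-Computational_Algebra.Polynomial"
begin

definition qpoch :: "real \<Rightarrow> real \<Rightarrow> nat \<Rightarrow> real" where
  "qpoch q z m = (\<Prod>j<m. 1 - z * q ^ j)"

definition gcoef :: "real \<Rightarrow> real \<Rightarrow> nat \<Rightarrow> real" where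
  "gcoef q \<mu> m = qpoch q \<mu> m / qpoch q q m"

text \<open>The Fock space, the direct sum of the lines spanned by the vectors \<open>|m\<rangle>\<close>, is the vector space
  underlying the complex polynomials, with the monomials as the basis vectors; the multiplication
  of polynomials plays no role.\<close>

type_synonym fock = "complex poly"

definition ket :: "nat \<Rightarrow> fock" where
  "ket m = monom 1 m"

definition lin_ext :: "(nat \<Rightarrow> fock) \<Rightarrow> fock \<Rightarrow> fock" where
  "lin_ext w v = (\<Sum>m\<le>degree v. smult (coeff v m) (w m))"

definition op_b :: "fock \<Rightarrow> fock" where
  "op_b = lin_ext (\<lambda>m. ket (m + 1))"

text \<open>For \<open>m = 0\<close> the factor \<open>1 - q ^ m\<close> vanishes, so the truncated subtraction is harmless.\<close>

definition op_c :: "real \<Rightarrow> fock \<Rightarrow> fock" where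
  "op_c q = lin_ext (\<lambda>m. smult (complex_of_real (1 - q ^ m)) (ket (m - 1)))"

definition op_k :: "real \<Rightarrow> fock \<Rightarrow> fock" where
  "op_k q = lin_ext (\<lambda>m. smult (complex_of_real (q ^ m)) (ket m))"

definition basis_op :: "real \<Rightarrow> int \<times> nat \<Rightarrow> fock \<Rightarrow> fock" where
  "basis_op q = (\<lambda>(t, u). (op_b ^^ nat t) \<circ> (op_k q ^^ u) \<circ> (op_c q ^^ nat (- t)))"

definition op_lincomb :: "real \<Rightarrow> (int \<times> nat \<Rightarrow> complex) \<Rightarrow> fock \<Rightarrow> fock" where
  "op_lincomb q f = (\<lambda>v. \<Sum>x | f x \<noteq> 0. smult (f x) (basis_op q x v))"

text \<open>For \<open>0 < q < 1\<close> the operators \<open>basis_op q x\<close> form a basis of the algebra generated by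
  \<open>op_b\<close>, \<open>op_c q\<close> and \<open>op_k q\<close>, so the coefficients are well defined for every \<open>Q\<close> in this algebra
  (and meaningless otherwise).\<close>

definition op_coeffs :: "real \<Rightarrow> (fock \<Rightarrow> fock) \<Rightarrow> int \<times> nat \<Rightarrow> complex" where
  "op_coeffs q Q = (THE f. finite {x. f x \<noteq> 0} \<and> Q = op_lincomb q f)"

definition k_proj :: "real \<Rightarrow> (fock \<Rightarrow> fock) \<Rightarrow> fock \<Rightarrow> fock" where
  "k_proj q Q = op_lincomb q (\<lambda>(t, u). if t = 0 \<and> u \<ge> 1 then op_coeffs q Q (t, u) else 0)"

text \<open>The linear functional sending \<open>op_k q ^^ u\<close> to \<open>1 / (1 - q ^ u)\<close> for \<open>u \<ge> 1\<close>; it is only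
  meant to be applied to elements of the span of these powers.\<close>

definition k_trace :: "real \<Rightarrow> (fock \<Rightarrow> fock) \<Rightarrow> complex" where
  "k_trace q Q = (\<Sum>u | u \<ge> 1 \<and> op_coeffs q Q (0, u) \<noteq> 0.
                    op_coeffs q Q (0, u) / complex_of_real (1 - q ^ u))"

text \<open>The summand of \<open>X\<^sub>a\<^sub>,\<^sub>n\<close> that contains the \<open>j\<close>-th power of \<open>op_b\<close>. The infinite sum
  over \<open>j\<close> is not an operator on the Fock space and is only used through its summands.\<close>

definition X_term :: "real \<Rightarrow> real \<Rightarrow> nat \<Rightarrow> nat \<Rightarrow> nat \<Rightarrow> fock \<Rightarrow> fock" where
  "X_term q \<mu> a n j = (\<lambda>v.
     smult (complex_of_real (qpoch q \<mu> (a + n) / (qpoch q q a * qpoch q q n) * gcoef q \<mu> j))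
       ((op_b ^^ j) ((op_k q ^^ n) ((op_c q ^^ a) v))))"

text \<open>A product of matrix product operators is given by the list of its factors, where
  \<open>MX a n\<close> stands for \<open>X\<^sub>a\<^sub>,\<^sub>n\<close> and \<open>MA a\<close> for \<open>A\<^sub>a\<close>.\<close>

datatype mp_factor = MX nat nat | MA nat

text \<open>\<open>factor_term q \<mu> w N j\<close> is the part of the factor \<open>w\<close> that contains \<open>y ^ N\<close> and the
  \<open>j\<close>-th power of \<open>op_b\<close>, without the scalar \<open>y ^ N\<close>; only \<open>A\<^sub>a\<close> involves \<open>y\<close>.\<close>

fun factor_term :: "real \<Rightarrow> real \<Rightarrow> mp_factor \<Rightarrow> nat \<Rightarrow> nat \<Rightarrow> fock \<Rightarrow> fock" where
  "factor_term q \<mu> (MX a n) N j = (if N = 0 then X_term q \<mu> a n j else (\<lambda>v. 0))"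
| "factor_term q \<mu> (MA a) N j = X_term q \<mu> a N j"

fun num_c :: "mp_factor \<Rightarrow> nat" where
  "num_c (MX a n) = a"
| "num_c (MA a) = a"

definition prod_term :: "real \<Rightarrow> real \<Rightarrow> mp_factor list \<Rightarrow> nat list \<Rightarrow> nat list \<Rightarrow> fock \<Rightarrow> fock" where
  "prod_term q \<mu> ws ns js =
     foldr (\<circ>) (map (\<lambda>i. factor_term q \<mu> (ws ! i) (ns ! i) (js ! i)) [0..<length ws]) id"

text \<open>The coefficient of \<open>y ^ N\<close> in the primed trace. Only the terms with as many \<open>op_b\<close> as
  \<open>op_c\<close> are included: the others have projection zero.\<close>

definition mp_trace_coeff :: "real \<Rightarrow> real \<Rightarrow> mp_factor list \<Rightarrow> nat \<Rightarrow> complex" where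
  "mp_trace_coeff q \<mu> ws N =
     (\<Sum>(ns, js) \<in> {(ns, js). length ns = length ws \<and> length js = length ws \<and>
                       sum_list ns = N \<and> sum_list js = sum_list (map num_c ws)}.
        k_trace q (k_proj q (prod_term q \<mu> ws ns js)))"

definition mp_trace :: "real \<Rightarrow> real \<Rightarrow> real \<Rightarrow> mp_factor list \<Rightarrow> complex" where
  "mp_trace q \<mu> y ws = (\<Sum>N. mp_trace_coeff q \<mu> ws N * complex_of_real y ^ N)"

text \<open>\<open>A_word d i j\<close> is the product of the \<open>A\<close>-operators for \<open>d i, \<dots>, d j\<close>.\<close>

definition A_word :: "(nat \<Rightarrow> nat) \<Rightarrow> nat \<Rightarrow> nat \<Rightarrow> mp_factor list" where
  "A_word d i j = map (\<lambda>l. MA (d l)) [i..<Suc j]"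

definition Z_part :: "real \<Rightarrow> real \<Rightarrow> real \<Rightarrow> nat \<Rightarrow> (nat \<Rightarrow> nat) \<Rightarrow> nat \<Rightarrow> complex" where
  "Z_part q \<mu> y s d L = mp_trace q \<mu> y (A_word d 1 s @ replicate (L - s) (MA 0))"

text \<open>In the following limits the truncated subtractions are only relevant for finitely many \<open>L\<close>.
  As the scalars of the Fock space are complex, so are the types of the probabilities and of the
  densities.\<close>

definition P_I :: "real \<Rightarrow> real \<Rightarrow> real \<Rightarrow> nat \<Rightarrow> (nat \<Rightarrow> nat) \<Rightarrow> nat \<Rightarrow> nat \<Rightarrow> complex" where
  "P_I q \<mu> y s d r n = lim (\<lambda>L. inverse (Z_part q \<mu> y s d L) * complex_of_real y ^ n *
     mp_trace q \<mu> y (A_word d 1 (r - 1) @ [MX (d r) n] @ A_word d (r + 1) s @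
                     replicate (L - s) (MA 0)))"

definition P_II :: "real \<Rightarrow> real \<Rightarrow> real \<Rightarrow> nat \<Rightarrow> (nat \<Rightarrow> nat) \<Rightarrow> nat \<Rightarrow> nat \<Rightarrow> complex" where
  "P_II q \<mu> y s d r n = lim (\<lambda>L. inverse (Z_part q \<mu> y s d L) * complex_of_real y ^ n *
     mp_trace q \<mu> y (A_word d 1 s @ replicate (r - s - 1) (MA 0) @ [MX 0 n] @
                     replicate (L - r) (MA 0)))"

definition P_III :: "real \<Rightarrow> real \<Rightarrow> real \<Rightarrow> nat \<Rightarrow> (nat \<Rightarrow> nat) \<Rightarrow> int \<Rightarrow> nat \<Rightarrow> complex" where
  "P_III q \<mu> y s d r n = lim (\<lambda>L. inverse (Z_part q \<mu> y s d L) * complex_of_real y ^ n *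
     mp_trace q \<mu> y ([MX 0 n] @ replicate (nat \<bar>r\<bar>) (MA 0) @ A_word d 1 s @
                     replicate (L - nat \<bar>r\<bar> - s - 1) (MA 0)))"

definition rho_I :: "real \<Rightarrow> real \<Rightarrow> real \<Rightarrow> nat \<Rightarrow> (nat \<Rightarrow> nat) \<Rightarrow> nat \<Rightarrow> complex" where
  "rho_I q \<mu> y s d r = (\<Sum>n. of_nat n * P_I q \<mu> y s d r n)"

definition rho_II :: "real \<Rightarrow> real \<Rightarrow> real \<Rightarrow> nat \<Rightarrow> (nat \<Rightarrow> nat) \<Rightarrow> nat \<Rightarrow> complex" where
  "rho_II q \<mu> y s d r = (\<Sum>n. of_nat n * P_II q \<mu> y s d r n)"

definition rho_III :: "real \<Rightarrow> real \<Rightarrow> real \<Rightarrow> nat \<Rightarrow> (nat \<Rightarrow> nat) \<Rightarrow> int \<Rightarrow> complex" where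
  "rho_III q \<mu> y s d r = (\<Sum>n. of_nat n * P_III q \<mu> y s d r n)"

definition local_density :: "real \<Rightarrow> real \<Rightarrow> real \<Rightarrow> nat \<Rightarrow> (nat \<Rightarrow> nat) \<Rightarrow> int \<Rightarrow> complex" where
  "local_density q \<mu> y s d r =
     (if r \<le> 0 then rho_III q \<mu> y s d r
      else if r \<le> int s then rho_I q \<mu> y s d (nat r)
      else rho_II q \<mu> y s d (nat r))"

definition avg_density :: "real \<Rightarrow> real \<Rightarrow> real \<Rightarrow> real" where
  "avg_density q \<mu> y = (\<Sum>i. (1 - \<mu>) * y * q ^ i / ((1 - y * q ^ i) * (1 - \<mu> * y * q ^ i)))"

definition total_excess :: "real \<Rightarrow> real \<Rightarrow> real \<Rightarrow> nat \<Rightarrow> (nat \<Rightarrow> nat) \<Rightarrow> complex" where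
  "total_excess q \<mu> y s d =
     (\<Sum>\<^sub>\<infinity>r\<in>UNIV. local_density q \<mu> y s d r - complex_of_real (avg_density q \<mu> y))"

end

theory Submission
  imports Defs
begin

text \<open>A long block of \<open>A\<^sub>0\<close> projects onto the vacuum: its diagonal entries \<open>H 0 (y * q ^ m)\<close>
  are largest at level \<open>m = 0\<close>, so in the limit the traces become \<open>\<langle>0|\<dots>|v\<rangle>\<close>, where \<open>v\<close> is the
  eigenvector of \<open>A\<^sub>0\<close> for its top eigenvalue. This \<open>v\<close> has components
  \<open>(\<mu> y)\<^sub>m / (y\<^sup>m (q)\<^sub>m)\<close> and is an eigenvector of every \<open>A\<^sub>a\<close>, with eigenvalue proportional to
  \<open>y\<^sup>-\<^sup>a H 0 y\<close>. With \<open>\<theta> = y d/dy\<close> the density at a site carrying \<open>a\<close> first class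
  particles is \<open>\<langle>0|A\<^sub>1 \<dots> A\<^sub>r\<^sub>-\<^sub>1 (\<theta> A\<^sub>a)|v\<rangle>\<close>, suitably normalised. Applying \<open>\<theta>\<close> to the eigenvalue
  equation turns it into \<open>\<rho> - a + e\<^sub>r\<^sub>-\<^sub>1 - e\<^sub>r\<close>, where \<open>e\<^sub>r\<close> is the normalised
  \<open>\<langle>0|A\<^sub>1 \<dots> A\<^sub>r|\<theta> v\<rangle>\<close>. Since \<open>\<theta> v\<close> has no vacuum component, \<open>e\<^sub>0 = 0\<close> and \<open>e\<^sub>r\<close> decays
  geometrically, so the sum telescopes.\<close>

section \<open>Operators on the Fock space\<close>

text \<open>Two obstacles shape the proof. The trace is defined through coefficients in a basis of
  the operator algebra, which mean something only once the basis operators are known to be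
  independent. Since 1/(1 - q^u) is the sum of q^(u m) over m, the trace then becomes a sum of
  diagonal entries over all levels m, from which the prime removes the \<open>k^0\<close> part. The
  dominance of level 0 must then survive the sums over all m and over all powers of y. Above the
  vacuum the diagonal entries of the block are at most H(q y), but the block is not diagonal:
  weighting each b by \<tau> controls the raising of levels, at the price of a factor H(\<tau>) per
  site. As H(q y)/H(y) = (1 - y)/(1 - \<mu> y) < 1 and H(\<tau>) tends to 1 for \<tau> to 0, some
  \<tau> leaves a gap H(q y) H(\<tau>) < H(y). This one gap gives both the limits of the traces and
  the decay of \<open>e\<^sub>r\<close>. Everything explicit comes from H being (\<mu>
  z)_\<infinity>/(z)_\<infinity>, which enters through its functional equation under z -> q z; the
  logarithmic derivative of that equation, iterated, is the series for \<rho>.\<close>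

lemma lin_ext_altdef:
  assumes "degree v \<le> M"
  shows "lin_ext w v = (\<Sum>m\<le>M. smult (coeff v m) (w m))"
  unfolding lin_ext_def
  by (rule sum.mono_neutral_left) (use assms in \<open>auto simp: coeff_eq_0\<close>)

definition fock_linear :: "(fock \<Rightarrow> fock) \<Rightarrow> bool" where
  "fock_linear T \<longleftrightarrow> (\<forall>u v. T (u + v) = T u + T v) \<and> (\<forall>c v. T (smult c v) = smult c (T v))"

lemma fock_linear_add: "fock_linear T \<Longrightarrow> T (u + v) = T u + T v"
  and fock_linear_smult: "fock_linear T \<Longrightarrow> T (smult c v) = smult c (T v)"
  by (auto simp: fock_linear_def)

lemma smult_sum_right: "smult c (\<Sum>x\<in>A. f x) = (\<Sum>x\<in>A. smult c (f x :: 'a :: comm_semiring_0 poly))"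
  by (induction A rule: infinite_finite_induct) (auto simp: smult_add_right)

lemma fock_linear_zero: "fock_linear T \<Longrightarrow> T 0 = 0"
  using fock_linear_smult[of T 0 0] by simp

lemma fock_linear_sum: "fock_linear T \<Longrightarrow> T (\<Sum>x\<in>A. f x) = (\<Sum>x\<in>A. T (f x))"
  by (induction A rule: infinite_finite_induct) (auto simp: fock_linear_zero fock_linear_add)

lemma fock_linear_lin_ext: "fock_linear (lin_ext w)"
  unfolding fock_linear_def
proof safe
  fix u v :: fock and c :: complex
  let ?M = "max (degree u) (degree v)"
  have d: "degree (u + v) \<le> ?M" by (rule degree_add_le_max)
  show "lin_ext w (u + v) = lin_ext w u + lin_ext w v"
    by (simp add: lin_ext_altdef[OF d] lin_ext_altdef[of u ?M] lin_ext_altdef[of v ?M]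
        smult_add_left sum.distrib)
  have d: "degree (smult c v) \<le> degree v" by (rule degree_smult_le)
  show "lin_ext w (smult c v) = smult c (lin_ext w v)"
    by (simp add: lin_ext_altdef[OF d] lin_ext_altdef[of v "degree v"] smult_sum_right)
qed

lemma fock_linear_id: "fock_linear id"
  by (simp add: fock_linear_def)

lemma fock_linear_comp: "fock_linear S \<Longrightarrow> fock_linear T \<Longrightarrow> fock_linear (S \<circ> T)"
  by (simp add: fock_linear_def)

lemma fock_linear_funpow: "fock_linear T \<Longrightarrow> fock_linear (T ^^ n)"
  by (induction n) (auto intro: fock_linear_comp simp: fock_linear_id)

lemma fock_linear_scale: "fock_linear T \<Longrightarrow> fock_linear (\<lambda>v. smult c (T v))"
  by (simp add: fock_linear_def smult_add_right mult.commute)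

lemma fock_linear_sum_fun:
  "(\<And>x. x \<in> A \<Longrightarrow> fock_linear (T x)) \<Longrightarrow> fock_linear (\<lambda>v. \<Sum>x\<in>A. T x v)"
  by (simp add: fock_linear_def sum.distrib smult_sum_right)

lemma fock_linear_ops: "fock_linear op_b" "fock_linear (op_c q)" "fock_linear (op_k q)"
  by (simp_all add: op_b_def op_c_def op_k_def fock_linear_lin_ext)

lemma fock_linear_eqI:
  assumes "fock_linear S" "fock_linear T" "\<And>m. S (ket m) = T (ket m)"
  shows "S = T"
proof
  fix v :: fock
  have v: "v = (\<Sum>m\<le>degree v. smult (coeff v m) (ket m))"
    by (simp add: ket_def smult_monom poly_as_sum_of_monoms)
  show "S v = T v"
    by (subst (1 2) v) (simp add: fock_linear_sum fock_linear_smult assms)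
qed

section \<open>Action of normally ordered words on the basis vectors\<close>

lemma lin_ext_ket: "lin_ext w (ket m) = w m"
proof -
  have "lin_ext w (ket m) = (\<Sum>i\<le>m. smult (coeff (ket m) i) (w i))"
    by (rule lin_ext_altdef) (simp add: ket_def degree_monom_le)
  also have "\<dots> = (\<Sum>i\<in>{m}. smult (coeff (ket m) i) (w i))"
    by (rule sum.mono_neutral_right) (auto simp: ket_def)
  finally show ?thesis by (simp add: ket_def)
qed

text \<open>The scalar that appears when \<open>op_c\<close> is applied a times at level l. The
  truncated exponent is harmless: for l < a the factor at i = l is 1 - q^0, so the product vanishes
  as it should.\<close>

definition cprod :: "real \<Rightarrow> nat \<Rightarrow> nat \<Rightarrow> real" where
  "cprod q l a = (\<Prod>i<a. 1 - q ^ (l - i))"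

lemma cprod_Suc: "cprod q l (Suc a) = cprod q l a * (1 - q ^ (l - a))"
  by (simp add: cprod_def)

lemma cprod_0 [simp]: "cprod q l 0 = 1"
  by (simp add: cprod_def)

lemma cprod_eq_0: "l < a \<Longrightarrow> cprod q l a = 0"
  unfolding cprod_def by (rule prod_zero) (auto intro!: bexI[of _ l])

lemma op_b_pow_ket: "(op_b ^^ j) (ket m) = ket (m + j)"
  by (induction j) (auto simp: op_b_def lin_ext_ket)

lemma op_k_pow_ket: "(op_k q ^^ n) (ket m) = smult (complex_of_real (q ^ (n * m))) (ket m)"
  by (induction n)
     (auto simp: fock_linear_smult[OF fock_linear_ops(3)] op_k_def lin_ext_ket fock_linear_smult[OF fock_linear_lin_ext]
        power_add mult.commute)

lemma op_c_pow_ket: "(op_c q ^^ a) (ket m) = smult (complex_of_real (cprod q m a)) (ket (m - a))"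
  by (induction a)
     (auto simp: op_c_def lin_ext_ket fock_linear_smult[OF fock_linear_lin_ext] cprod_Suc)

lemma normal_op_ket:
  "(op_b ^^ j) ((op_k q ^^ n) ((op_c q ^^ a) (ket m))) =
     smult (complex_of_real (cprod q m a * q ^ (n * (m - a)))) (ket (m - a + j))"
  by (simp add: op_c_pow_ket fock_linear_smult[OF fock_linear_funpow] fock_linear_ops
      op_k_pow_ket op_b_pow_ket)

lemma basis_op_ket:
  "basis_op q (t, u) (ket m) =
     smult (complex_of_real (cprod q m (nat (- t)) * q ^ (u * (m - nat (- t)))))
       (ket (m - nat (- t) + nat t))"
  by (simp add: basis_op_def normal_op_ket)

lemma fock_linear_basis_op: "fock_linear (basis_op q x)"
  by (cases x) (auto simp: basis_op_def intro!: fock_linear_comp fock_linear_funpow fock_linear_ops)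

lemma fock_linear_op_lincomb: "fock_linear (op_lincomb q f)"
  unfolding op_lincomb_def by (intro fock_linear_sum_fun fock_linear_scale fock_linear_basis_op)

text \<open>Fixing the initial and the final level isolates a single shift t, whose part depends
  polynomially on q^k. Starting at k + max(-t, 0) leaves enough room for the c's, so that the
  prefactor does not vanish when 0 < q < 1.\<close>

lemma coeff_op_lincomb_ket:
  assumes f: "finite {x. f x \<noteq> 0}" and M: "\<And>u. f (t, u) \<noteq> 0 \<Longrightarrow> u \<le> M"
  shows "coeff (op_lincomb q f (ket (k + nat (- t)))) (k + nat t) =
           complex_of_real (cprod q (k + nat (- t)) (nat (- t))) *
           poly (\<Sum>u\<le>M. monom (f (t, u)) u) (complex_of_real (q ^ k))"
proof -
  let ?m = "k + nat (- t)"
  \<comment> \<open>Another shift either annihilates the vector or ends at another level.\<close>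
  have z: "coeff (basis_op q (t', u) (ket ?m)) (k + nat t) = 0" if "t' \<noteq> t" for t' u
  proof (cases "?m < nat (- t')")
    case True
    then show ?thesis by (simp add: basis_op_ket cprod_eq_0)
  next
    case False
    then have "?m - nat (- t') + nat t' \<noteq> k + nat t" using that by linarith
    then show ?thesis by (simp only: basis_op_ket) (simp add: ket_def)
  qed
  have "coeff (op_lincomb q f (ket ?m)) (k + nat t) =
      (\<Sum>x | f x \<noteq> 0. f x * coeff (basis_op q x (ket ?m)) (k + nat t))"
    by (simp add: op_lincomb_def coeff_sum)
  also have "\<dots> = (\<Sum>x \<in> Pair t ` {u. u \<le> M}. f x * coeff (basis_op q x (ket ?m)) (k + nat t))"
  proof (rule sum.mono_neutral_cong)
    fix x assume x: "x \<in> {x. f x \<noteq> 0} - Pair t ` {u. u \<le> M}"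
    obtain t' u where tu: "x = (t', u)" by (cases x)
    have "t' \<noteq> t" using x M by (auto simp: tu)
    then show "f x * coeff (basis_op q x (ket ?m)) (k + nat t) = 0"
      using z by (simp add: tu)
  qed (use f in auto)
  also have "\<dots> = (\<Sum>u\<le>M. f (t, u) * coeff (basis_op q (t, u) (ket ?m)) (k + nat t))"
    by (subst sum.reindex) (auto simp: inj_on_def atMost_def)
  also have "\<dots> = complex_of_real (cprod q ?m (nat (- t))) *
           poly (\<Sum>u\<le>M. monom (f (t, u)) u) (complex_of_real (q ^ k))"
    by (simp only: basis_op_ket) (simp add: ket_def poly_sum poly_monom sum_distrib_left mult_ac
        flip: power_mult)
  finally show ?thesis .
qed

section \<open>Independence of the basis operators and the primed trace of a diagonal
  operator\<close>

lemma cprod_pos: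
  assumes "0 < q" "q < 1" "a \<le> l"
  shows "cprod q l a > 0"
  unfolding cprod_def by (rule prod_pos) (use assms in \<open>auto simp: power_less_one_iff\<close>)

lemma poly_eq_on_powers:
  fixes p p' :: "complex poly" and q :: real
  assumes q: "0 < q" "q < 1"
  assumes eq: "\<And>k. poly p (complex_of_real (q ^ k)) = poly p' (complex_of_real (q ^ k))"
  shows "p = p'"
proof (rule ccontr)
  assume "p \<noteq> p'"
  then have "finite {x. poly (p - p') x = 0}"
    by (intro poly_roots_finite) auto
  moreover have "range (\<lambda>k. complex_of_real (q ^ k)) \<subseteq> {x. poly (p - p') x = 0}"
    using eq by auto
  moreover have "inj (\<lambda>k. complex_of_real (q ^ k))"
  proof (rule injI)
    fix k l assume "complex_of_real (q ^ k) = complex_of_real (q ^ l)"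
    then have "q ^ k = q ^ l" by (simp only: of_real_eq_iff)
    then show "k = l" using power_strict_decreasing[of k l q] power_strict_decreasing[of l k q] q
      by (cases k l rule: linorder_cases) auto
  qed
  ultimately show False
    using finite_subset range_inj_infinite by blast
qed

text \<open>A polynomial is determined by its values at the infinitely many points q^k, so the
  matrix elements determine all coefficients of a given shift. This independence gives the definite
  description in \<open>op_coeffs\<close> its meaning.\<close>

lemma op_lincomb_inject:
  assumes q: "0 < q" "q < 1" and f: "finite {x. f x \<noteq> 0}" "finite {x. f' x \<noteq> 0}"
    and eq: "op_lincomb q f = op_lincomb q f'"
  shows "f = f'"
proof
  fix x :: "int \<times> nat"
  obtain t u where x: "x = (t, u)" by (cases x)
  \<comment> \<open>One bound M for the k-exponents of both families; u itself is included so that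
    the coefficient at u can be read off at the end.\<close>
  define S where "S = insert u (snd ` ({x. f x \<noteq> 0} \<union> {x. f' x \<noteq> 0}))"
  have finS: "finite S" using f by (auto simp: S_def)
  define M where "M = Max S"
  have M: "v \<le> M" if "v \<in> S" for v
    using finS that by (simp add: M_def)
  have Mf: "v \<le> M" if "f (t, v) \<noteq> 0" for v
    by (rule M) (use that in \<open>force simp: S_def\<close>)
  have Mf': "v \<le> M" if "f' (t, v) \<noteq> 0" for v
    by (rule M) (use that in \<open>force simp: S_def\<close>)
  have "(\<Sum>v\<le>M. monom (f (t, v)) v) = (\<Sum>v\<le>M. monom (f' (t, v)) v)"
  proof (rule poly_eq_on_powers[OF q])
    fix k
    have "cprod q (k + nat (- t)) (nat (- t)) \<noteq> 0"
      using cprod_pos[OF q, of "nat (- t)" "k + nat (- t)"] by simp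
    moreover have "coeff (op_lincomb q f (ket (k + nat (- t)))) (k + nat t) =
           complex_of_real (cprod q (k + nat (- t)) (nat (- t))) *
             poly (\<Sum>v\<le>M. monom (f (t, v)) v) (complex_of_real (q ^ k))"
      by (rule coeff_op_lincomb_ket) (use f Mf in auto)
    moreover have "coeff (op_lincomb q f' (ket (k + nat (- t)))) (k + nat t) =
           complex_of_real (cprod q (k + nat (- t)) (nat (- t))) *
             poly (\<Sum>v\<le>M. monom (f' (t, v)) v) (complex_of_real (q ^ k))"
      by (rule coeff_op_lincomb_ket) (use f Mf' in auto)
    ultimately show "poly (\<Sum>v\<le>M. monom (f (t, v)) v) (complex_of_real (q ^ k)) =
             poly (\<Sum>v\<le>M. monom (f' (t, v)) v) (complex_of_real (q ^ k))"
      unfolding eq by (simp del: of_real_power)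
  qed
  from arg_cong[OF this, of "\<lambda>p. coeff p u"] have "f (t, u) = f' (t, u)"
    using M[of u] by (simp add: coeff_sum S_def)
  then show "f x = f' x" by (simp add: x)
qed

lemma op_coeffs_op_lincomb:
  assumes "0 < q" "q < 1" "finite {x. f x \<noteq> 0}"
  shows "op_coeffs q (op_lincomb q f) = f"
  unfolding op_coeffs_def using assms by (intro the_equality) (auto intro: op_lincomb_inject)

lemma finite_diag_support: "finite {x. (case x of (t :: int, u) \<Rightarrow> if t = 0 \<and> P u then coeff p u else 0) \<noteq> (0 :: complex)}"
proof (rule finite_subset)
  show "{x. (case x of (t :: int, u) \<Rightarrow> if t = 0 \<and> P u then coeff p u else 0) \<noteq> 0} \<subseteq> Pair 0 ` {..degree p}"
    by (auto split: if_splits intro!: imageI le_degree)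
qed auto

text \<open>The eigenvalues p(q^m) identify the operator with p evaluated at \<open>op_k q\<close>.
  By independence the coefficients of p are its \<open>op_coeffs\<close>, so projection and trace
  can be computed on p.\<close>

lemma k_trace_k_proj_diag:
  assumes q: "0 < q" "q < 1" and Q: "fock_linear Q"
    and diag: "\<And>m. Q (ket m) = smult (complex_of_real (poly p (q ^ m))) (ket m)"
  shows "k_trace q (k_proj q Q) = complex_of_real (\<Sum>u=1..degree p. coeff p u / (1 - q ^ u))"
proof -
  define P where "P = map_poly complex_of_real p"
  have cP: "coeff P u = complex_of_real (coeff p u)" for u
    by (simp add: P_def coeff_map_poly)
  define f where "f = (\<lambda>(t :: int, u). if t = 0 \<and> True then coeff P u else 0)"
  have finf: "finite {x. f x \<noteq> 0}" unfolding f_def by (rule finite_diag_support)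
  have "Q = op_lincomb q f"
  proof (rule fock_linear_eqI[OF Q fock_linear_op_lincomb])
    fix m
    have "op_lincomb q f (ket m) = (\<Sum>x | f x \<noteq> 0. smult (f x) (basis_op q x (ket m)))"
      by (simp add: op_lincomb_def)
    also have "\<dots> = (\<Sum>x \<in> Pair 0 ` {..degree p}. smult (f x) (basis_op q x (ket m)))"
    proof (rule sum.mono_neutral_left)
      show "{x. f x \<noteq> 0} \<subseteq> Pair 0 ` {..degree p}"
        by (auto simp: f_def cP split: if_splits intro!: imageI le_degree)
    qed auto
    also have "\<dots> = (\<Sum>u\<le>degree p. smult (coeff P u) (smult (complex_of_real (q ^ (u * m))) (ket m)))"
      by (subst sum.reindex) (auto simp: inj_on_def basis_op_ket f_def)
    also have "\<dots> = smult (complex_of_real (poly p (q ^ m))) (ket m)"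
      by (simp add: poly_altdef cP smult_sum mult.commute flip: power_mult)
    finally show "Q (ket m) = op_lincomb q f (ket m)" using diag by simp
  qed
  then have cQ: "op_coeffs q Q = f"
    using op_coeffs_op_lincomb[OF q finf] by simp
  define f1 where "f1 = (\<lambda>(t :: int, u). if t = 0 \<and> u \<ge> 1 then coeff P u else 0)"
  have finf1: "finite {x. f1 x \<noteq> 0}" unfolding f1_def by (rule finite_diag_support)
  have "k_proj q Q = op_lincomb q f1"
    unfolding k_proj_def cQ f1_def f_def
    by (rule arg_cong[where f = "op_lincomb q"]) (auto simp: fun_eq_iff)
  then have c1: "op_coeffs q (k_proj q Q) = f1"
    using op_coeffs_op_lincomb[OF q finf1] by simp
  have "k_trace q (k_proj q Q) =
      (\<Sum>u | u \<ge> 1 \<and> f1 (0, u) \<noteq> 0. f1 (0, u) / complex_of_real (1 - q ^ u))"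
    by (simp add: k_trace_def c1)
  also have "\<dots> = (\<Sum>u=1..degree p. f1 (0, u) / complex_of_real (1 - q ^ u))"
    by (rule sum.mono_neutral_left) (auto simp: f1_def cP intro: le_degree)
  also have "\<dots> = (\<Sum>u=1..degree p. complex_of_real (coeff p u) / complex_of_real (1 - q ^ u))"
    by (rule sum.cong) (auto simp: f1_def cP)
  finally show ?thesis by simp
qed

text \<open>Expanding 1/(1 - q^u) as a geometric series in m turns the formal trace into a sum over
  the levels of the Fock space. The subtracted constant term is the \<open>k^0\<close> part removed
  by the prime; it would contribute the same amount at every level.\<close>

lemma poly_diff_sums_geometric:
  fixes q :: real
  assumes q: "0 < q" "q < 1"
  shows "(\<lambda>m. poly p (q ^ m) - poly p 0) sums (\<Sum>u=1..degree p. coeff p u / (1 - q ^ u))"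
proof -
  have *: "poly p x - poly p 0 = (\<Sum>u=1..degree p. coeff p u * x ^ u)" for x
  proof -
    have "poly p x = (\<Sum>u\<le>degree p. coeff p u * x ^ u)" by (rule poly_altdef)
    also have "{..degree p} = insert 0 {1..degree p}" by auto
    also have "(\<Sum>u\<in>insert 0 {1..degree p}. coeff p u * x ^ u)
        = poly p 0 + (\<Sum>u=1..degree p. coeff p u * x ^ u)"
      by (subst sum.insert) (auto simp: poly_0_coeff_0)
    finally show ?thesis by simp
  qed
  have "(\<lambda>m. \<Sum>u=1..degree p. coeff p u * (q ^ u) ^ m) sums
          (\<Sum>u=1..degree p. coeff p u * (1 / (1 - q ^ u)))"
  proof (intro sums_sum sums_mult geometric_sums)
    fix u assume "u \<in> {1..degree p}"
    then show "norm (q ^ u) < 1" using q by (auto simp: power_less_one_iff)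
  qed
  then show ?thesis
    by (simp add: * mult.commute flip: power_mult)
qed

section \<open>Closed paths and their traces\<close>

fun kexp :: "mp_factor \<Rightarrow> nat \<Rightarrow> nat" where
  "kexp (MX a n) N = n"
| "kexp (MA a) N = N"

abbreviation csum :: "mp_factor list \<Rightarrow> nat" where
  "csum ws \<equiv> sum_list (map num_c ws)"

text \<open>Summands \<open>b\<^sup>j k\<^sup>n c\<^sup>a\<close> of the factors, applied from right to left, move \<open>|m\<rangle>\<close> along a path of
  levels ending at \<open>path_level\<close>. The truncated subtraction matters only for paths leaving the Fock
  space, and these have \<open>path_cfactor = 0\<close>.\<close>

fun path_level :: "mp_factor list \<Rightarrow> nat list \<Rightarrow> nat \<Rightarrow> nat" where
  "path_level (w # ws) (j # js) m = path_level ws js m - num_c w + j"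
| "path_level _ _ m = m"

fun path_ksum :: "mp_factor list \<Rightarrow> nat list \<Rightarrow> nat" where
  "path_ksum (w # ws) (n # ns) = kexp w n + path_ksum ws ns"
| "path_ksum _ _ = 0"

fun path_kpow :: "mp_factor list \<Rightarrow> nat list \<Rightarrow> nat list \<Rightarrow> nat \<Rightarrow> nat" where
  "path_kpow (w # ws) (n # ns) (j # js) m = kexp w n * (path_level ws js m - num_c w) + path_kpow ws ns js m"
| "path_kpow _ _ _ m = 0"

definition level_shift :: "mp_factor list \<Rightarrow> nat list \<Rightarrow> int" where
  "level_shift ws js = int (sum_list js) - int (csum ws)"

lemma words_induct [consumes 2, case_names Nil Cons]:
  assumes "length ns = length ws" "length js = length ws"
    and "P [] [] []"
    and "\<And>w ws n ns j js. length ns = length ws \<Longrightarrow> length js = length ws \<Longrightarrow> P ws ns js \<Longrightarrow>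
           P (w # ws) (n # ns) (j # js)"
  shows "P ws ns js"
  using assms(1,2)
proof (induction ws arbitrary: ns js)
  case Nil
  then show ?case using assms(3) by simp
next
  case (Cons w ws)
  then show ?case using assms(4) by (cases ns; cases js) auto
qed

lemma path_level_ge: "m \<le> path_level ws js m + csum ws"
  by (induction ws js m rule: path_level.induct) auto

section \<open>Weights of paths as polynomials in q^m\<close>

locale q_mu =
  fixes q \<mu> :: real
  assumes q: "0 < q" "q < 1" and mu: "0 < \<mu>" "\<mu> < 1"
begin

definition kap :: "nat \<Rightarrow> nat \<Rightarrow> real" where
  "kap a n = qpoch q \<mu> (a + n) / (qpoch q q a * qpoch q q n)"

abbreviation g :: "nat \<Rightarrow> real" where "g \<equiv> kap 0"

lemma gcoef_eq: "gcoef q \<mu> n = g n"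
  by (simp add: gcoef_def kap_def qpoch_def)

lemma qpoch_pos: "0 \<le> z \<Longrightarrow> z < 1 \<Longrightarrow> qpoch q z n > 0"
  unfolding qpoch_def
proof (rule prod_pos)
  fix i assume "0 \<le> z" "z < 1"
  moreover have "z * q ^ i \<le> z * 1"
    using q \<open>0 \<le> z\<close> by (intro mult_left_mono power_le_one) auto
  ultimately have "z * q ^ i < 1" by simp
  then show "0 < 1 - z * q ^ i" by simp
qed

lemma kap_pos: "kap a n > 0"
  using q mu by (auto simp: kap_def intro!: divide_pos_pos mult_pos_pos qpoch_pos)

lemma g_0 [simp]: "g 0 = 1"
  by (simp add: kap_def qpoch_def)

fun factor_scalar :: "mp_factor \<Rightarrow> nat \<Rightarrow> real" where
  "factor_scalar (MX a n) N = (if N = 0 then kap a n else 0)"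
| "factor_scalar (MA a) N = kap a N"

lemma factor_scalar_nonneg: "factor_scalar w n \<ge> 0"
  by (cases w) (auto intro: less_imp_le kap_pos)

fun path_scalar :: "mp_factor list \<Rightarrow> nat list \<Rightarrow> nat list \<Rightarrow> real" where
  "path_scalar (w # ws) (n # ns) (j # js) = factor_scalar w n * g j * path_scalar ws ns js"
| "path_scalar _ _ _ = 1"

lemma path_scalar_nonneg: "path_scalar ws ns js \<ge> 0"
  by (induction ws ns js rule: path_scalar.induct) (auto intro: mult_nonneg_nonneg factor_scalar_nonneg less_imp_le[OF kap_pos])

fun path_cfactor :: "mp_factor list \<Rightarrow> nat list \<Rightarrow> nat \<Rightarrow> real" where
  "path_cfactor (w # ws) (j # js) m = cprod q (path_level ws js m) (num_c w) * path_cfactor ws js m"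
| "path_cfactor _ _ m = 1"

definition path_value :: "mp_factor list \<Rightarrow> nat list \<Rightarrow> nat list \<Rightarrow> nat \<Rightarrow> real" where
  "path_value ws ns js m = path_scalar ws ns js * path_cfactor ws js m * q ^ path_kpow ws ns js m"

lemma path_value_Nil [simp]: "path_value [] ns js m = 1"
  by (simp add: path_value_def)

lemma path_value_Cons: "path_value (w # ws) (n # ns) (j # js) m =
    factor_scalar w n * g j * cprod q (path_level ws js m) (num_c w) * q ^ (kexp w n * (path_level ws js m - num_c w)) *
    path_value ws ns js m"
  by (simp add: path_value_def power_add)

lemma factor_term_eq:
  "factor_term q \<mu> w N j = (\<lambda>v. smult (complex_of_real (factor_scalar w N * g j))
     ((op_b ^^ j) ((op_k q ^^ kexp w N) ((op_c q ^^ num_c w) v))))"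
  by (cases w) (auto simp: X_term_def gcoef_eq kap_def fun_eq_iff)

lemma fock_linear_factor_term: "fock_linear (factor_term q \<mu> w N j)"
  unfolding factor_term_eq
  by (intro fock_linear_scale)
     (use fock_linear_comp[OF fock_linear_funpow[OF fock_linear_ops(1)]
        fock_linear_comp[OF fock_linear_funpow[OF fock_linear_ops(3)] fock_linear_funpow[OF fock_linear_ops(2)]]]
      in \<open>simp add: o_def\<close>)

lemma prod_term_Nil [simp]: "prod_term q \<mu> [] ns js = id"
  by (simp add: prod_term_def)

lemma prod_term_Cons [simp]:
  "prod_term q \<mu> (w # ws) (n # ns) (j # js) = factor_term q \<mu> w n j \<circ> prod_term q \<mu> ws ns js"
proof -
  have "[0..<length (w # ws)] = 0 # map Suc [0..<length ws]"
    by (simp add: map_Suc_upt upt_conv_Cons del: upt_Suc)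
  then show ?thesis by (simp add: prod_term_def o_def del: upt_Suc)
qed

lemma fock_linear_prod_term:
  assumes "length ns = length ws" "length js = length ws"
  shows "fock_linear (prod_term q \<mu> ws ns js)"
  using assms
proof (induction ws ns js rule: words_induct)
  case (Cons w ws n ns j js)
  then show ?case
    unfolding prod_term_Cons by (intro fock_linear_comp fock_linear_factor_term)
qed (simp add: fock_linear_id[unfolded id_def])

lemma prod_term_ket:
  assumes "length ns = length ws" "length js = length ws"
  shows "prod_term q \<mu> ws ns js (ket m) = smult (complex_of_real (path_value ws ns js m)) (ket (path_level ws js m))"
  using assms
proof (induction ws ns js rule: words_induct)
  case (Cons w ws n ns j js)
  have "prod_term q \<mu> (w # ws) (n # ns) (j # js) (ket m) =
      smult (complex_of_real (path_value ws ns js m)) (factor_term q \<mu> w n j (ket (path_level ws js m)))"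
    by (simp add: Cons.IH fock_linear_smult[OF fock_linear_factor_term])
  also have "factor_term q \<mu> w n j (ket (path_level ws js m)) =
     smult (complex_of_real (factor_scalar w n * g j * (cprod q (path_level ws js m) (num_c w) *
        q ^ (kexp w n * (path_level ws js m - num_c w))))) (ket (path_level ws js m - num_c w + j))"
    by (simp only: factor_term_eq normal_op_ket smult_smult of_real_mult)
  finally show ?case
    by (simp add: path_value_Cons mult_ac)
qed auto

text \<open>The factor \<open>cprod\<close> at level m + e as a polynomial in x = q^m. The shift e
  may be negative, hence the integer powers.\<close>

definition cpoly :: "int \<Rightarrow> nat \<Rightarrow> real poly" where
  "cpoly e a = (\<Prod>i<a. [:1, - (q powi (e - int i)):])"

fun path_poly :: "mp_factor list \<Rightarrow> nat list \<Rightarrow> nat list \<Rightarrow> real poly" where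
  "path_poly (w # ws) (n # ns) (j # js) = smult (factor_scalar w n * g j) (cpoly (level_shift ws js) (num_c w) *
     [:0, q powi (level_shift ws js - int (num_c w)):] ^ kexp w n * path_poly ws ns js)"
| "path_poly _ _ _ = 1"

lemma poly_cpoly:
  assumes "int l = int m + e"
  shows "poly (cpoly e a) (q ^ m) = cprod q l a"
proof (cases "l < a")
  case True
  have "poly (cpoly e a) (q ^ m) = 0"
    unfolding cpoly_def poly_prod
  proof (rule prod_zero)
    show "\<exists>i\<in>{..<a}. poly [:1, - (q powi (e - int i)):] (q ^ m) = 0"
    proof (rule bexI[of _ l])
      have "q ^ m * q powi (e - int l) = q powi (int m + (e - int l))"
        using q by (subst power_int_add) auto
      also have "int m + (e - int l) = 0" using assms by simp
      finally show "poly [:1, - (q powi (e - int l)):] (q ^ m) = 0" by simp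
    qed (use True in auto)
  qed auto
  then show ?thesis using True by (simp add: cprod_eq_0)
next
  case False
  have "q ^ m * q powi (e - int i) = q ^ (l - i)" if "i < a" for i
  proof -
    have "q ^ m * q powi (e - int i) = q powi (int m + (e - int i))"
      using q by (subst power_int_add) auto
    also have "int m + (e - int i) = int (l - i)" using assms that False by simp
    finally show ?thesis by (simp only: power_int_of_nat)
  qed
  then show ?thesis by (simp add: cpoly_def cprod_def poly_prod)
qed

text \<open>The identity has to hold at every m, also for paths that leave the Fock space. There the
  truncated \<open>path_level\<close> differs from the true shift, but both sides vanish because
  some c-factor contains 1 - q^0. The level is therefore claimed only for nonzero values, and the
  induction carries both parts together.\<close>

lemma path_value_poly:
  assumes "length ns = length ws" "length js = length ws"
  shows "path_value ws ns js m = poly (path_poly ws ns js) (q ^ m) \<and>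
    (path_value ws ns js m \<noteq> 0 \<longrightarrow> int (path_level ws js m) = int m + level_shift ws js)"
  using assms
proof (induction ws ns js rule: words_induct)
  case Nil
  then show ?case by (simp add: level_shift_def)
next
  case (Cons w ws n ns j js)
  let ?e = "level_shift ws js" and ?l = "path_level ws js m" and ?a = "num_c w"
  show ?case
  proof (cases "path_value ws ns js m = 0")
    case True
    with Cons.IH show ?thesis by (simp add: path_value_Cons)
  next
    case False
    with Cons.IH have l: "int ?l = int m + ?e" by simp
    have c: "poly (cpoly ?e ?a) (q ^ m) = cprod q ?l ?a" by (rule poly_cpoly[OF l])
    show ?thesis
    proof (cases "?l < ?a")
      case True
      then show ?thesis by (simp add: path_value_Cons c cprod_eq_0)
    next
      case False
      have "q ^ m * q powi (?e - int ?a) = q powi (int m + (?e - int ?a))"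
        using q by (subst power_int_add) auto
      also have "int m + (?e - int ?a) = int (?l - ?a)" using l False by simp
      finally have "q ^ m * q powi (?e - int ?a) = q ^ (?l - ?a)" by (simp only: power_int_of_nat)
      then have "path_value (w # ws) (n # ns) (j # js) m = poly (path_poly (w # ws) (n # ns) (j # js)) (q ^ m)"
        using Cons.IH by (simp add: path_value_Cons c mult_ac flip: power_mult)
      moreover have "int (path_level (w # ws) (j # js) m) = int m + level_shift (w # ws) (j # js)"
        using l False by (simp add: level_shift_def)
      ultimately show ?thesis by blast
    qed
  qed
qed

text \<open>At x = 0 every c-factor becomes 1 and every k contributes a factor x, so a word
  containing some k has no constant term.\<close>

lemma poly_path_poly_0:
  assumes "length ns = length ws" "length js = length ws"
  shows "poly (path_poly ws ns js) 0 = (if path_ksum ws ns = 0 then path_scalar ws ns js else 0)"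
  using assms by (induction ws ns js rule: words_induct) (auto simp: cpoly_def poly_prod)

definition ptrace :: "real poly \<Rightarrow> real" where
  "ptrace p = (\<Sum>u=1..degree p. coeff p u / (1 - q ^ u))"

lemma ptrace_sums: "(\<lambda>m. poly p (q ^ m) - poly p 0) sums ptrace p"
  unfolding ptrace_def by (rule poly_diff_sums_geometric[OF q])

text \<open>With as many b's as c's, every path of nonzero value returns to its starting level,
  which makes the word diagonal.\<close>

lemma k_trace_prod_term:
  assumes len: "length ns = length ws" "length js = length ws" and bal: "sum_list js = csum ws"
  shows "k_trace q (k_proj q (prod_term q \<mu> ws ns js)) = complex_of_real (ptrace (path_poly ws ns js))"
  unfolding ptrace_def
proof (rule k_trace_k_proj_diag[OF q fock_linear_prod_term[OF len]])
  fix m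
  show "prod_term q \<mu> ws ns js (ket m) = smult (complex_of_real (poly (path_poly ws ns js) (q ^ m))) (ket m)"
  proof (cases "path_value ws ns js m = 0")
    case True
    then show ?thesis using path_value_poly[OF len, of m] by (simp add: prod_term_ket[OF len])
  next
    case False
    then have "path_level ws js m = m" using path_value_poly[OF len, of m] bal by (simp add: level_shift_def)
    then show ?thesis using path_value_poly[OF len, of m] by (simp add: prod_term_ket[OF len])
  qed
qed

section \<open>Contribution of the levels above the vacuum\<close>

lemma q_pow: "0 \<le> q ^ n" "q ^ n \<le> 1"
  using q by (auto intro: power_le_one)

lemma mult_ge_one_minus:
  fixes A B :: real
  assumes "A \<le> 1" "B \<le> 1" "1 - x \<le> A" "1 - y \<le> B"
  shows "1 - (x + y) \<le> A * B"
proof -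
  have "0 \<le> (1 - A) * (1 - B)" using assms by simp
  then show ?thesis using assms by (simp add: algebra_simps)
qed

lemma cprod_bounds: "0 \<le> cprod q l a" "cprod q l a \<le> 1"
  using q_pow unfolding cprod_def by (auto intro!: prod_nonneg prod_le_1)

lemma cprod_ge: "1 - real a * q ^ (l - a) \<le> cprod q l a"
proof -
  have "1 - real b * q ^ (l - a) \<le> cprod q l b" if "b \<le> a" for b
    using that
  proof (induction b)
    case (Suc b)
    have "q ^ (l - b) \<le> q ^ (l - a)"
      by (rule power_decreasing) (use Suc q in auto)
    then have "1 - (real b * q ^ (l - a) + q ^ (l - a)) \<le> cprod q l b * (1 - q ^ (l - b))"
      using Suc by (intro mult_ge_one_minus cprod_bounds) (auto simp: q_pow)
    then show ?case by (simp add: cprod_Suc algebra_simps)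
  qed auto
  then show ?thesis by blast
qed

lemma path_cfactor_bounds: "0 \<le> path_cfactor ws js m" "path_cfactor ws js m \<le> 1"
  by (induction ws js m rule: path_cfactor.induct) (auto intro: mult_le_one cprod_bounds mult_nonneg_nonneg)

text \<open>A path never sinks by more than the number of its c's, so far above the vacuum all
  c-factors are geometrically close to 1. This makes the words without k summable over m once their
  constant term is subtracted.\<close>

lemma path_cfactor_ge: "1 - real (csum ws) * q ^ (m - csum ws) \<le> path_cfactor ws js m"
proof (induction ws js m rule: path_cfactor.induct)
  case (1 w ws j js m)
  let ?a = "num_c w" and ?l = "path_level ws js m"
  have "m \<le> ?l + csum ws" by (rule path_level_ge)
  then have "q ^ (?l - ?a) \<le> q ^ (m - csum (w # ws))"
    by (intro power_decreasing) (use q in auto)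
  then have "real ?a * q ^ (?l - ?a) \<le> real ?a * q ^ (m - csum (w # ws))"
    by (intro mult_left_mono) auto
  then have a: "1 - real ?a * q ^ (m - csum (w # ws)) \<le> cprod q ?l ?a"
    using cprod_ge[of ?a ?l] by simp
  have "q ^ (m - csum ws) \<le> q ^ (m - csum (w # ws))"
    by (intro power_decreasing) (use q in auto)
  then have "real (csum ws) * q ^ (m - csum ws) \<le> real (csum ws) * q ^ (m - csum (w # ws))"
    by (intro mult_left_mono) auto
  then have b: "1 - real (csum ws) * q ^ (m - csum (w # ws)) \<le> path_cfactor ws js m"
    using 1 by simp
  show ?case
    using mult_ge_one_minus[OF cprod_bounds(2) path_cfactor_bounds(2) a b] by (simp add: algebra_simps)
qed (auto simp: q_pow)

abbreviation vac :: "nat \<Rightarrow> mp_factor list" where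
  "vac L \<equiv> replicate L (MA 0)"

lemma path_kpow_vac: "length ns = L \<Longrightarrow> length js = L \<Longrightarrow> sum_list ns * m \<le> path_kpow (vac L) ns js m"
proof (induction L arbitrary: ns js)
  case (Suc L)
  from Suc.prems obtain n ns' j js' where eq: "ns = n # ns'" "js = j # js'"
      "length ns' = L" "length js' = L"
    by (metis length_Suc_conv)
  have "m \<le> path_level (vac L) js' m" using path_level_ge[of m "vac L" js'] by (simp add: sum_list_replicate)
  then have "n * m \<le> n * path_level (vac L) js' m" by (rule mult_le_mono2)
  moreover have "sum_list ns' * m \<le> path_kpow (vac L) ns' js' m" using Suc.IH eq by simp
  ultimately have "n * m + sum_list ns' * m \<le> n * path_level (vac L) js' m + path_kpow (vac L) ns' js' m"
    by (rule add_mono)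
  then show ?case by (simp add: eq add_mult_distrib)
qed auto

lemma path_ksum_vac: "length ns = L \<Longrightarrow> path_ksum (vac L) ns = sum_list ns"
  by (induction L arbitrary: ns) (auto simp: length_Suc_conv)

text \<open>The block acts first and contains no c, so each of its k's sits at a level \<ge> m \<ge>
  1 and yields at least one factor q: this is what turns y into q y in the block. If any k occurs at
  all, one of them acts at level at least m - \<open>csum U\<close> and supplies the decay in m; the
  \<open>Suc\<close> pays for the factor q that this k may already have contributed to the first
  summand.\<close>

lemma path_kpow_ge:
  assumes "length ns = length U + L" "length js = length U + L" "m \<ge> 1"
  shows "sum_list (drop (length U) ns) + (if path_ksum (U @ vac L) ns \<ge> 1 then m - Suc (csum U) else 0)
           \<le> path_kpow (U @ vac L) ns js m"
  using assms(1,2)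
proof (induction U arbitrary: ns js)
  case Nil
  have "sum_list ns + (if sum_list ns \<ge> 1 then m - 1 else 0) \<le> sum_list ns * m"
  proof (cases "sum_list ns")
    case (Suc N)
    then show ?thesis using assms(3) by (cases m) auto
  next
    case 0
    then show ?thesis unfolding 0 by simp
  qed
  also have "\<dots> \<le> path_kpow (vac L) ns js m" using Nil by (intro path_kpow_vac) auto
  finally show ?case using Nil by (auto simp: path_ksum_vac)
next
  case (Cons w U)
  from Cons.prems obtain n ns' j js' where eq: "ns = n # ns'" "js = j # js'"
      "length ns' = length U + L" "length js' = length U + L"
    by (metis length_Suc_conv length_Cons add_Suc)
  note IH = Cons.IH[OF eq(3,4)]
  let ?l = "path_level (U @ vac L) js' m"
  have l: "m \<le> ?l + csum U" using path_level_ge[of m "U @ vac L" js'] by (simp add: sum_list_replicate)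
  show ?case
  proof (cases "kexp w n = 0")
    case True
    then show ?thesis using IH by (auto simp: eq split: if_splits)
  next
    case False
    have "m - Suc (csum (w # U)) \<le> ?l - num_c w" using l by simp
    also have "\<dots> \<le> kexp w n * (?l - num_c w)" using False by simp
    finally have "m - Suc (csum (w # U)) \<le> kexp w n * (?l - num_c w)" .
    then show ?thesis using IH by (auto simp: eq split: if_splits)
  qed
qed

text \<open>The trace is a sum over levels, and all levels but 0 are error. Words with some k are
  small there by \<open>path_kpow_ge\<close>; words without k contribute \<open>path_cfactor\<close>
  minus 1, and at level 0 their constant term. All cases are bounded by C q^m, whose sum gives the
  factor 1/(1 - q).\<close>

lemma ptrace_approx:
  assumes len: "length ns = length U + L" "length js = length U + L"
  defines "ws \<equiv> U @ vac L" and "D \<equiv> csum U"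
  shows "\<bar>ptrace (path_poly ws ns js) - path_value ws ns js 0\<bar> \<le>
     real (Suc D) / (q ^ Suc D * (1 - q)) * (path_scalar ws ns js * q ^ sum_list (drop (length U) ns))"
proof -
  let ?Z = "path_scalar ws ns js" and ?N = "sum_list (drop (length U) ns)"
  define C where "C = real (Suc D) / q ^ Suc D * (?Z * q ^ ?N)"
  define f where "f = (\<lambda>m. poly (path_poly ws ns js) (q ^ m) - poly (path_poly ws ns js) 0 -
      (if m = 0 then path_value ws ns js 0 else 0))"
  have len': "length ns = length ws" "length js = length ws" using len by (auto simp: ws_def)
  have D: "csum ws = D" by (simp add: ws_def D_def sum_list_replicate)
  have sm: "f sums (ptrace (path_poly ws ns js) - path_value ws ns js 0)"
    unfolding f_def by (intro sums_diff ptrace_sums sums_single[of 0 "\<lambda>_. path_value ws ns js 0", simplified])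
  \<comment> \<open>Without any k the power of q in C is 1, so the case without k fits the common
    bound.\<close>
  have N0: "?N = 0" if "path_ksum ws ns = 0"
  proof -
    have "sum_list (drop (length U) ns) \<le> path_ksum (U @ vac L) ns" using len(1)
      by (induction U arbitrary: ns) (auto simp: path_ksum_vac length_Suc_conv trans_le_add2)
    then show ?thesis using that by (simp add: ws_def)
  qed
  \<comment> \<open>For m < k the left side is 1 by truncation and the right side is at least
    1.\<close>
  have qm: "q ^ (m - k) \<le> q ^ m / q ^ k" for m k
  proof (cases "k \<le> m")
    case True
    then show ?thesis using q by (simp add: power_diff)
  next
    case False
    then show ?thesis using q by (simp add: power_decreasing)
  qed
  have fb: "norm (f m) \<le> C * q ^ m" for m
  proof (cases "path_ksum ws ns = 0")
    case True
    have one: "\<bar>f m\<bar> \<le> ?Z * (real (Suc D) * q ^ (m - D))"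
    proof (cases "m = 0")
      case True
      have "?Z * 1 \<le> ?Z * real (Suc D)" by (intro mult_left_mono path_scalar_nonneg) auto
      then show ?thesis using True \<open>path_ksum ws ns = 0\<close> path_value_poly[OF len', of 0]
        by (simp add: f_def poly_path_poly_0[OF len'] path_scalar_nonneg)
    next
      case False
      have "path_value ws ns js m = ?Z * path_cfactor ws js m * q ^ path_kpow ws ns js m" by (simp add: path_value_def)
      also have "path_kpow ws ns js m = 0"
        using len' True by (induction ws ns js rule: words_induct) auto
      finally have "f m = - (?Z * (1 - path_cfactor ws js m))"
        using False True path_value_poly[OF len', of m]
        by (simp add: f_def poly_path_poly_0[OF len'] algebra_simps)
      then have "\<bar>f m\<bar> = ?Z * (1 - path_cfactor ws js m)"
        using path_scalar_nonneg[of ws ns js] path_cfactor_bounds[of ws js m] by (simp add: abs_mult)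
      also have "\<dots> \<le> ?Z * (real (Suc D) * q ^ (m - D))"
      proof (intro mult_left_mono path_scalar_nonneg)
        have "1 - path_cfactor ws js m \<le> real D * q ^ (m - D)" using path_cfactor_ge[of ws m js] by (simp add: D)
        also have "\<dots> \<le> real (Suc D) * q ^ (m - D)" by (intro mult_right_mono q_pow) auto
        finally show "1 - path_cfactor ws js m \<le> real (Suc D) * q ^ (m - D)" .
      qed
      finally show ?thesis .
    qed
    also have "\<dots> \<le> ?Z * (real (Suc D) * (q ^ m / q ^ Suc D))"
    proof (intro mult_left_mono path_scalar_nonneg)
      have "q ^ (m - D) \<le> q ^ (m - Suc D)" by (intro power_decreasing) (use q in auto)
      then show "q ^ (m - D) \<le> q ^ m / q ^ Suc D" using qm[of m "Suc D"] by simp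
    qed auto
    also have "\<dots> = C * q ^ m" unfolding C_def N0[OF True] by simp
    finally show ?thesis by simp
  next
    case False
    show ?thesis
    proof (cases "m = 0")
      case True
      have "0 \<le> C" using q path_scalar_nonneg[of ws ns js] by (auto simp: C_def)
      then show ?thesis using True False path_value_poly[OF len', of 0]
        by (simp add: f_def poly_path_poly_0[OF len'])
    next
      case m: False
      have "f m = ?Z * path_cfactor ws js m * q ^ path_kpow ws ns js m"
        using m False path_value_poly[OF len', of m] by (simp add: f_def poly_path_poly_0[OF len'] path_value_def)
      moreover have "\<dots> \<ge> 0"
        by (intro mult_nonneg_nonneg path_scalar_nonneg path_cfactor_bounds q_pow)
      ultimately have "\<bar>f m\<bar> = ?Z * path_cfactor ws js m * q ^ path_kpow ws ns js m" by simp
      also have "\<dots> \<le> ?Z * 1 * q ^ (?N + (m - Suc D))"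
      proof (intro mult_mono path_cfactor_bounds path_scalar_nonneg power_decreasing)
        show "?N + (m - Suc D) \<le> path_kpow ws ns js m"
          using path_kpow_ge[OF len, of m] m False by (simp add: ws_def D_def)
      qed (use q path_scalar_nonneg path_cfactor_bounds in auto)
      also have "\<dots> = 1 * (?Z * q ^ ?N) * q ^ (m - Suc D)" by (simp add: power_add)
      also have "\<dots> \<le> real (Suc D) * (?Z * q ^ ?N) * (q ^ m / q ^ Suc D)"
        by (intro mult_mono qm) (use q path_scalar_nonneg[of ws ns js] in auto)
      also have "\<dots> = C * q ^ m" by (simp add: C_def)
      finally show ?thesis by simp
    qed
  qed
  have g: "(\<lambda>m. C * q ^ m) sums (C * (1 / (1 - q)))"
    by (intro sums_mult geometric_sums) (use q in auto)
  have "norm (suminf f) \<le> (\<Sum>m. C * q ^ m)"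
    using g by (intro norm_suminf_le fb) (simp add: sums_iff)
  then have "\<bar>ptrace (path_poly ws ns js) - path_value ws ns js 0\<bar> \<le> C * (1 / (1 - q))"
    using sm g by (simp add: sums_iff)
  also have "\<dots> = real (Suc D) / (q ^ Suc D * (1 - q)) * (?Z * q ^ ?N)"
    by (simp add: C_def field_simps)
  finally show ?thesis .
qed

end

section \<open>The trace as a vacuum matrix element\<close>

text \<open>Distributions of N powers of y and of J letters b over k factors.\<close>

definition weak_comps :: "nat \<Rightarrow> nat \<Rightarrow> nat \<Rightarrow> (nat list \<times> nat list) set" where
  "weak_comps k N J =
     {(ns, js). length ns = k \<and> length js = k \<and> sum_list ns = N \<and> sum_list js = J}"

lemma weak_comps_0: "weak_comps 0 N J = (if N = 0 \<and> J = 0 then {([], [])} else {})"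
  by (auto simp: weak_comps_def)

lemma finite_weak_comps [simp]: "finite (weak_comps k N J)"
proof (rule finite_subset)
  show "weak_comps k N J \<subseteq>
      {ns. set ns \<subseteq> {..N} \<and> length ns = k} \<times> {js. set js \<subseteq> {..J} \<and> length js = k}"
    by (auto simp: weak_comps_def intro: member_le_sum_list)
qed (auto intro: finite_lists_length_eq)

lemma sum_weak_comps_Suc:
  "(\<Sum>(ns, js)\<in>weak_comps (Suc k) N J. F ns js) =
     (\<Sum>n\<le>N. \<Sum>j\<le>J. \<Sum>(ns, js)\<in>weak_comps k (N - n) (J - j). F (n # ns) (j # js))"
proof -
  define h where "h = (\<lambda>((n :: nat, j :: nat), (ns, js)). (n # ns, j # js))"
  define S where "S = (SIGMA x:{..N} \<times> {..J}. weak_comps k (N - fst x) (J - snd x))"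
  have im: "weak_comps (Suc k) N J = h ` S"
  proof (intro equalityI subsetI)
    fix x assume x: "x \<in> weak_comps (Suc k) N J"
    then obtain n ns j js where eq: "x = (n # ns, j # js)"
      by (cases x) (auto simp: weak_comps_def length_Suc_conv)
    have "x = h ((n, j), (ns, js))" by (simp add: h_def eq)
    moreover have "((n, j), (ns, js)) \<in> S" using x by (auto simp: S_def eq weak_comps_def)
    ultimately show "x \<in> h ` S" by blast
  next
    fix x assume "x \<in> h ` S"
    then show "x \<in> weak_comps (Suc k) N J" by (auto simp: S_def h_def weak_comps_def)
  qed
  have inj: "inj_on h S" by (auto simp: inj_on_def h_def)
  have "(\<Sum>(ns, js)\<in>weak_comps (Suc k) N J. F ns js) = (\<Sum>z\<in>S. case h z of (ns, js) \<Rightarrow> F ns js)"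
    unfolding im by (subst sum.reindex[OF inj]) simp
  also have "\<dots> = (\<Sum>(x, z)\<in>S. case z of (ns, js) \<Rightarrow> F (fst x # ns) (snd x # js))"
    by (rule sum.cong) (auto simp: h_def)
  also have "\<dots> = (\<Sum>x\<in>{..N} \<times> {..J}. \<Sum>(ns, js)\<in>weak_comps k (N - fst x) (J - snd x). F (fst x # ns) (snd x # js))"
    unfolding S_def by (subst sum.Sigma) auto
  also have "\<dots> = (\<Sum>n\<le>N. \<Sum>j\<le>J. \<Sum>(ns, js)\<in>weak_comps k (N - n) (J - j). F (n # ns) (j # js))"
    by (subst sum.cartesian_product) (auto simp: case_prod_unfold)
  finally show ?thesis .
qed

lemma sum_list_boxes_Suc:
  fixes M J :: nat
  defines "B \<equiv> \<lambda>k. {ns. set ns \<subseteq> {..<M} \<and> length ns = k} \<times> {js. set js \<subseteq> {..J} \<and> length js = k}"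
  shows "(\<Sum>(ns, js)\<in>B (Suc k). F ns js) =
     (\<Sum>n<M. \<Sum>j\<le>J. \<Sum>(ns, js)\<in>B k. F (n # ns) (j # js))"
proof -
  define h where "h = (\<lambda>((n :: nat, j :: nat), (ns, js)). (n # ns, j # js))"
  define S where "S = ({..<M} \<times> {..J}) \<times> B k"
  have im: "B (Suc k) = h ` S"
  proof (intro equalityI subsetI)
    fix x assume x: "x \<in> B (Suc k)"
    then obtain n ns j js where eq: "x = (n # ns, j # js)"
      by (cases x) (auto simp: B_def length_Suc_conv)
    have "x = h ((n, j), (ns, js))" by (simp add: h_def eq)
    moreover have "((n, j), (ns, js)) \<in> S" using x by (auto simp: S_def eq B_def)
    ultimately show "x \<in> h ` S" by blast
  next
    fix x assume "x \<in> h ` S"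
    then show "x \<in> B (Suc k)" by (auto simp: S_def h_def B_def)
  qed
  have inj: "inj_on h S" by (auto simp: inj_on_def h_def)
  have "(\<Sum>(ns, js)\<in>B (Suc k). F ns js) = (\<Sum>z\<in>S. case h z of (ns, js) \<Rightarrow> F ns js)"
    unfolding im by (subst sum.reindex[OF inj]) simp
  also have "\<dots> = (\<Sum>(x, z)\<in>S. case z of (ns, js) \<Rightarrow> F (fst x # ns) (snd x # js))"
    by (rule sum.cong) (auto simp: h_def)
  also have "\<dots> = (\<Sum>x\<in>{..<M} \<times> {..J}. \<Sum>(ns, js)\<in>B k. F (fst x # ns) (snd x # js))"
    unfolding S_def by (rule sum.cartesian_product[symmetric])
  also have "\<dots> = (\<Sum>n<M. \<Sum>j\<le>J. \<Sum>(ns, js)\<in>B k. F (n # ns) (j # js))"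
    by (subst sum.cartesian_product) (auto simp: case_prod_unfold)
  finally show ?thesis .
qed

context q_mu
begin

section \<open>Generating functions of the coefficients\<close>

lemma qpoch_0 [simp]: "qpoch q z 0 = 1"
  by (simp add: qpoch_def)

lemma qpoch_Suc: "qpoch q z (Suc n) = qpoch q z n * (1 - z * q ^ n)"
  by (simp add: qpoch_def)

lemma q_pow_less_1: "q ^ Suc n < 1"
  using q power_Suc_less_one[of q n] by simp

lemma kap_Suc: "kap a (Suc n) = kap a n * ((1 - \<mu> * q ^ (a + n)) / (1 - q ^ Suc n))"
  by (simp add: kap_def qpoch_Suc)

lemma summable_kap:
  assumes "\<bar>z\<bar> < 1"
  shows "summable (\<lambda>n. kap a n * z ^ n)"
proof -
  \<comment> \<open>The midpoint of \<bar>z\<bar> and 1. Ratios of consecutive terms are at most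
    \<bar>z\<bar>/(1 - q^(n+1)), which tends to \<bar>z\<bar> and hence falls below c.\<close>
  define c where "c = (1 + \<bar>z\<bar>) / 2"
  have c: "c < 1" "\<bar>z\<bar> < c" using assms by (auto simp: c_def)
  have "(\<lambda>n. q ^ n) \<longlonglongrightarrow> 0" using q by (intro LIMSEQ_realpow_zero) auto
  then have "(\<lambda>n. \<bar>z\<bar> / (1 - q * q ^ n)) \<longlonglongrightarrow> \<bar>z\<bar> / (1 - q * 0)"
    by (intro tendsto_intros \<open>(\<lambda>n. q ^ n) \<longlonglongrightarrow> 0\<close>) auto
  then have "\<forall>\<^sub>F n in sequentially. \<bar>z\<bar> / (1 - q * q ^ n) < c"
    by (rule order_tendstoD) (use c in auto)
  then obtain n0 where n0: "\<And>n. n \<ge> n0 \<Longrightarrow> \<bar>z\<bar> / (1 - q ^ Suc n) < c"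
    by (auto simp: eventually_sequentially)
  show ?thesis
  proof (rule summable_ratio_test[OF c(1)])
    fix n assume n: "n \<ge> n0"
    have "0 < 1 - q ^ Suc n" using q_pow_less_1 by simp
    moreover have "\<mu> * q ^ (a + n) \<le> 1" using mu q by (intro mult_le_one power_le_one) auto
    moreover have "0 \<le> \<mu> * q ^ (a + n)" using mu q by simp
    ultimately have "\<bar>(1 - \<mu> * q ^ (a + n)) / (1 - q ^ Suc n)\<bar> \<le> 1 / (1 - q ^ Suc n)"
      by (simp add: abs_div divide_right_mono)
    then have "\<bar>(1 - \<mu> * q ^ (a + n)) / (1 - q ^ Suc n)\<bar> * \<bar>z\<bar> \<le> 1 / (1 - q ^ Suc n) * \<bar>z\<bar>"
      by (rule mult_right_mono) auto
    also have "\<dots> \<le> c" using n0[OF n] by simp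
    finally have "\<bar>(1 - \<mu> * q ^ (a + n)) / (1 - q ^ Suc n)\<bar> * \<bar>z\<bar> \<le> c" .
    then have "norm (kap a n * z ^ n) * (\<bar>(1 - \<mu> * q ^ (a + n)) / (1 - q ^ Suc n)\<bar> * \<bar>z\<bar>) \<le>
        norm (kap a n * z ^ n) * c" by (rule mult_left_mono) auto
    then show "norm (kap a (Suc n) * z ^ Suc n) \<le> c * norm (kap a n * z ^ n)"
      by (simp only: kap_Suc power_Suc norm_mult real_norm_def abs_mult mult_ac)
  qed
qed

text \<open>For \<bar>z\<bar> < 1 this is \<open>kap a 0\<close> times (\<mu> q^a
  z)_\<infinity>/(z)_\<infinity>, by the q-binomial theorem. At z = y q^i it is the contribution of
  the k's of \<open>MA a\<close> at level i.\<close>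

definition H :: "nat \<Rightarrow> real \<Rightarrow> real" where
  "H a z = (\<Sum>n. kap a n * z ^ n)"

lemma H_sums: "\<bar>z\<bar> < 1 \<Longrightarrow> (\<lambda>n. kap a n * z ^ n) sums H a z"
  unfolding H_def by (intro summable_sums summable_kap)

lemma H_ge: "0 \<le> z \<Longrightarrow> z < 1 \<Longrightarrow> kap a 0 \<le> H a z"
  using sum_le_suminf[OF summable_kap[of z a], of "{0}"] less_imp_le[OF kap_pos[of a]]
  by (auto simp: H_def)

lemma H_pos: "0 \<le> z \<Longrightarrow> z < 1 \<Longrightarrow> 0 < H a z"
  using H_ge[of z a] kap_pos[of a 0] by simp

lemma H_mono: "0 \<le> z \<Longrightarrow> z \<le> z' \<Longrightarrow> z' < 1 \<Longrightarrow> H a z \<le> H a z'"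
  unfolding H_def
  by (intro suminf_le summable_kap mult_left_mono power_mono less_imp_le[OF kap_pos]) auto

fun k_factor :: "real \<Rightarrow> mp_factor \<Rightarrow> nat \<Rightarrow> real" where
  "k_factor y (MX a n) i = kap a n * q ^ (n * i)"
| "k_factor y (MA a) i = H a (y * q ^ i)"

lemma yq_bounds:
  assumes "0 \<le> y" "y < 1"
  shows "0 \<le> y * q ^ i" "y * q ^ i < 1"
proof -
  show "0 \<le> y * q ^ i" using assms q by simp
  have "y * q ^ i \<le> y * 1" using assms q by (intro mult_left_mono power_le_one) auto
  then show "y * q ^ i < 1" using assms by simp
qed

lemma k_factor_sums:
  assumes "0 \<le> y" "y < 1"
  shows "(\<lambda>n. factor_scalar w n * q ^ (kexp w n * i) * y ^ n) sums k_factor y w i"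
proof (cases w)
  case (MX a n)
  have "(\<lambda>N. if N = 0 then kap a n * q ^ (n * i) else 0) sums (kap a n * q ^ (n * i))"
    using sums_single[of 0 "\<lambda>_. kap a n * q ^ (n * i)"] by simp
  also have "(\<lambda>N. if N = 0 then kap a n * q ^ (n * i) else 0) =
      (\<lambda>N. factor_scalar w N * q ^ (kexp w N * i) * y ^ N)"
    by (auto simp: MX)
  finally show ?thesis by (simp add: MX)
next
  case (MA a)
  show ?thesis
    using H_sums[of "y * q ^ i" a] yq_bounds[OF assms, of i]
    by (simp add: MA power_mult_distrib mult_ac flip: power_mult)
qed

text \<open>The factor as an infinite matrix, with the series in y already summed: l is the level
  before it, m the level after it, and m + \<open>num_c w\<close> - l the number of b's. Each row is
  finite, so the matrix acts on arbitrary sequences, in particular on an eigenvector outside the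
  Fock space.\<close>

definition mp_op :: "real \<Rightarrow> mp_factor \<Rightarrow> (nat \<Rightarrow> real) \<Rightarrow> nat \<Rightarrow> real" where
  "mp_op y w x m = (\<Sum>l\<le>m + num_c w.
     k_factor y w (l - num_c w) * (cprod q l (num_c w) * g (m + num_c w - l)) * x l)"

abbreviation vac_state :: "nat \<Rightarrow> real" where
  "vac_state m \<equiv> (if m = 0 then 1 else 0)"

text \<open>The coefficient of y^N in the component at level m of the word applied to |0>: ending at
  m takes m more b's than c's.\<close>

definition vac_column :: "mp_factor list \<Rightarrow> nat \<Rightarrow> nat \<Rightarrow> real" where
  "vac_column ws N m = (\<Sum>(ns, js)\<in>weak_comps (length ws) N (m + csum ws). path_value ws ns js 0)"

lemma vac_column_Cons:
  "vac_column (w # ws) N m = (\<Sum>n\<le>N. \<Sum>l\<le>m + num_c w.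
     factor_scalar w n * q ^ (kexp w n * (l - num_c w)) * (cprod q l (num_c w) * g (m + num_c w - l)) *
     vac_column ws (N - n) l)"
proof -
  let ?a = "num_c w" and ?A = "csum ws" and ?k = "length ws"
  define J where "J = m + ?a + ?A"
  have "(\<Sum>j\<le>J. \<Sum>(ns, js)\<in>weak_comps ?k (N - n) (J - j). path_value (w # ws) (n # ns) (j # js) 0) =
     (\<Sum>l\<le>m + ?a. factor_scalar w n * q ^ (kexp w n * (l - ?a)) * (cprod q l ?a * g (m + ?a - l)) * vac_column ws (N - n) l)"
    if "n \<le> N" for n
  proof -
    have "(\<Sum>j\<le>J. \<Sum>(ns, js)\<in>weak_comps ?k (N - n) (J - j). path_value (w # ws) (n # ns) (j # js) 0) =
       (\<Sum>j\<le>m + ?a. \<Sum>(ns, js)\<in>weak_comps ?k (N - n) (J - j). path_value (w # ws) (n # ns) (j # js) 0)"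
    \<comment> \<open>With more than m + \<open>num_c w\<close> letters b in the first factor, the
      remaining path would have to end below level 0; such paths have value 0.\<close>
    proof (rule sum.mono_neutral_right)
      show "\<forall>j\<in>{..J} - {..m + ?a}.
          (\<Sum>(ns, js)\<in>weak_comps ?k (N - n) (J - j). path_value (w # ws) (n # ns) (j # js) 0) = 0"
      proof
        fix j assume j: "j \<in> {..J} - {..m + ?a}"
        have "path_value ws ns js 0 = 0" if "(ns, js) \<in> weak_comps ?k (N - n) (J - j)" for ns js
        proof (rule ccontr)
          assume "path_value ws ns js 0 \<noteq> 0"
          then have "int (path_level ws js 0) = int (J - j) - int ?A"
            using path_value_poly[of ns ws js 0] that by (auto simp: weak_comps_def level_shift_def)
          then show False using j by (simp add: J_def)
        qed
        then show "(\<Sum>(ns, js)\<in>weak_comps ?k (N - n) (J - j). path_value (w # ws) (n # ns) (j # js) 0) = 0"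
          by (intro sum.neutral) (auto simp: path_value_Cons)
      qed
    qed (auto simp: J_def)
    also have "\<dots> = (\<Sum>j\<le>m + ?a. factor_scalar w n * q ^ (kexp w n * (m + ?a - j - ?a)) *
        (cprod q (m + ?a - j) ?a * g j) * vac_column ws (N - n) (m + ?a - j))"
    proof (rule sum.cong)
      fix j assume j: "j \<in> {..m + ?a}"
      let ?l = "m + ?a - j"
      have Jj: "J - j = ?l + ?A" using j by (simp add: J_def)
      have "path_value (w # ws) (n # ns) (j # js) 0 =
          factor_scalar w n * q ^ (kexp w n * (?l - ?a)) * (cprod q ?l ?a * g j) * path_value ws ns js 0"
        if "(ns, js) \<in> weak_comps ?k (N - n) (J - j)" for ns js
      proof (cases "path_value ws ns js 0 = 0")
        case False
        then have "int (path_level ws js 0) = int (J - j) - int ?A"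
          using path_value_poly[of ns ws js 0] that by (auto simp: weak_comps_def level_shift_def)
        then have "path_level ws js 0 = ?l" using Jj by simp
        then show ?thesis by (simp add: path_value_Cons)
      qed (simp add: path_value_Cons)
      then have "(\<Sum>(ns, js)\<in>weak_comps ?k (N - n) (J - j). path_value (w # ws) (n # ns) (j # js) 0) =
         (\<Sum>(ns, js)\<in>weak_comps ?k (N - n) (J - j).
           factor_scalar w n * q ^ (kexp w n * (?l - ?a)) * (cprod q ?l ?a * g j) * path_value ws ns js 0)"
        by (intro sum.cong) auto
      then show "(\<Sum>(ns, js)\<in>weak_comps ?k (N - n) (J - j). path_value (w # ws) (n # ns) (j # js) 0) =
         factor_scalar w n * q ^ (kexp w n * (?l - ?a)) * (cprod q ?l ?a * g j) * vac_column ws (N - n) ?l"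
        by (simp add: vac_column_def Jj sum_distrib_left case_prod_unfold)
    qed auto
    also have "\<dots> = (\<Sum>l\<le>m + ?a. factor_scalar w n * q ^ (kexp w n * (l - ?a)) * (cprod q l ?a * g (m + ?a - l)) * vac_column ws (N - n) l)"
      by (rule sum.reindex_bij_witness[of _ "\<lambda>l. m + ?a - l" "\<lambda>j. m + ?a - j"]) auto
    finally show ?thesis .
  qed
  then show ?thesis
    by (simp add: vac_column_def[of "w # ws"] sum_weak_comps_Suc J_def add.assoc)
qed

lemma vac_column_nonneg: "vac_column ws N m \<ge> 0"
  unfolding vac_column_def path_value_def
  by (intro sum_nonneg) (auto intro!: mult_nonneg_nonneg path_scalar_nonneg path_cfactor_bounds q_pow)

text \<open>Adding a factor multiplies power series in y. All coefficients are nonnegative, so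
  convergence is absolute and the Cauchy product applies.\<close>

lemma vac_column_sums:
  assumes y: "0 \<le> y" "y < 1"
  shows "(\<lambda>N. vac_column ws N m * y ^ N) sums foldr (mp_op y) ws vac_state m"
proof (induction ws arbitrary: m)
  case Nil
  have "(\<lambda>N. vac_column [] N m * y ^ N) = (\<lambda>N. if N = 0 then vac_state m else 0)"
    by (auto simp: vac_column_def weak_comps_0 fun_eq_iff)
  then show ?case using sums_single[of 0 "\<lambda>_. vac_state m"] by simp
next
  case (Cons w ws)
  let ?a = "num_c w"
  let ?R = "foldr (mp_op y) ws vac_state"
  have *: "(\<lambda>N. \<Sum>n\<le>N. (factor_scalar w n * q ^ (kexp w n * i) * y ^ n) * (vac_column ws (N - n) l * y ^ (N - n)))
      sums (k_factor y w i * ?R l)" for i l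
  proof -
    have a: "summable (\<lambda>n. norm (factor_scalar w n * q ^ (kexp w n * i) * y ^ n))"
      using k_factor_sums[OF y, of w i] y q factor_scalar_nonneg by (simp add: sums_iff abs_mult)
    have b: "summable (\<lambda>n. norm (vac_column ws n l * y ^ n))"
      using Cons[of l] y vac_column_nonneg by (simp add: sums_iff abs_mult)
    show ?thesis
      using Cauchy_product_sums[OF a b] k_factor_sums[OF y, of w i] Cons[of l] by (simp add: sums_iff)
  qed
  have "(\<lambda>N. \<Sum>l\<le>m + ?a. cprod q l ?a * g (m + ?a - l) *
      (\<Sum>n\<le>N. (factor_scalar w n * q ^ (kexp w n * (l - ?a)) * y ^ n) * (vac_column ws (N - n) l * y ^ (N - n))))
      sums (\<Sum>l\<le>m + ?a. cprod q l ?a * g (m + ?a - l) * (k_factor y w (l - ?a) * ?R l))"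
    by (intro sums_sum sums_mult *)
  also have "(\<lambda>N. \<Sum>l\<le>m + ?a. cprod q l ?a * g (m + ?a - l) *
      (\<Sum>n\<le>N. (factor_scalar w n * q ^ (kexp w n * (l - ?a)) * y ^ n) * (vac_column ws (N - n) l * y ^ (N - n))))
     = (\<lambda>N. vac_column (w # ws) N m * y ^ N)"
  proof
    fix N
    have "vac_column (w # ws) N m * y ^ N = (\<Sum>n\<le>N. \<Sum>l\<le>m + ?a.
       factor_scalar w n * q ^ (kexp w n * (l - ?a)) * (cprod q l ?a * g (m + ?a - l)) * vac_column ws (N - n) l * (y ^ n * y ^ (N - n)))"
      by (simp add: vac_column_Cons sum_distrib_right flip: power_add)
    also have "\<dots> = (\<Sum>l\<le>m + ?a. \<Sum>n\<le>N.
       factor_scalar w n * q ^ (kexp w n * (l - ?a)) * (cprod q l ?a * g (m + ?a - l)) * vac_column ws (N - n) l * (y ^ n * y ^ (N - n)))"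
      by (rule sum.swap)
    finally show "(\<Sum>l\<le>m + ?a. cprod q l ?a * g (m + ?a - l) *
      (\<Sum>n\<le>N. (factor_scalar w n * q ^ (kexp w n * (l - ?a)) * y ^ n) * (vac_column ws (N - n) l * y ^ (N - n))))
      = vac_column (w # ws) N m * y ^ N"
      by (simp add: sum_distrib_left mult_ac)
  qed
  also have "(\<Sum>l\<le>m + ?a. cprod q l ?a * g (m + ?a - l) * (k_factor y w (l - ?a) * ?R l)) =
      foldr (mp_op y) (w # ws) vac_state m"
    by (simp add: mp_op_def mult_ac)
  finally show ?case .
qed

section \<open>Factorised majorants and the error of the vacuum approximation\<close>

fun weight_prod :: "(nat \<Rightarrow> real) list \<Rightarrow> nat list \<Rightarrow> nat list \<Rightarrow> real" where
  "weight_prod (u # us) (n # ns) (j # js) = u n * g j * weight_prod us ns js"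
| "weight_prod _ _ _ = 1"

lemma weight_prod_nonneg: "(\<And>u n. u \<in> set us \<Longrightarrow> 0 \<le> u n) \<Longrightarrow> 0 \<le> weight_prod us ns js"
  by (induction us ns js rule: weight_prod.induct) (auto intro!: mult_nonneg_nonneg less_imp_le[OF kap_pos])

lemma sum_boxes_weight_prod:
  fixes M J :: nat and \<tau> :: real
  shows "(\<Sum>(ns, js)\<in>{ns. set ns \<subseteq> {..<M} \<and> length ns = length us} \<times>
            {js. set js \<subseteq> {..J} \<and> length js = length us}. weight_prod us ns js * \<tau> ^ sum_list js) =
         (\<Prod>u\<leftarrow>us. (\<Sum>n<M. u n) * (\<Sum>j\<le>J. g j * \<tau> ^ j))"
proof (induction us)
  case Nil
  have "{ns :: nat list. set ns \<subseteq> {..<M} \<and> length ns = 0} \<times> {js :: nat list. set js \<subseteq> {..J} \<and> length js = 0} = {([], [])}"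
    by auto
  then show ?case by simp
next
  case (Cons u us)
  let ?B = "{ns. set ns \<subseteq> {..<M} \<and> length ns = length us} \<times> {js. set js \<subseteq> {..J} \<and> length js = length us}"
  define S where "S = (\<Sum>(ns, js)\<in>?B. weight_prod us ns js * \<tau> ^ sum_list js)"
  have "(\<Sum>n<M. \<Sum>j\<le>J. \<Sum>(ns, js)\<in>?B. weight_prod (u # us) (n # ns) (j # js) * \<tau> ^ sum_list (j # js)) =
      (\<Sum>n<M. \<Sum>j\<le>J. u n * (g j * \<tau> ^ j) * S)"
    by (simp add: S_def sum_distrib_left case_prod_unfold power_add mult_ac)
  also have "\<dots> = (\<Sum>n<M. u n) * (\<Sum>j\<le>J. g j * \<tau> ^ j) * S"
  proof -
    have "(\<Sum>n<M. u n) * (\<Sum>j\<le>J. g j * \<tau> ^ j) * S = (\<Sum>n<M. u n * ((\<Sum>j\<le>J. g j * \<tau> ^ j) * S))"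
      by (simp only: sum_distrib_right mult.assoc)
    then show ?thesis by (simp add: sum_distrib_left sum_distrib_right mult.assoc)
  qed
  finally show ?case
    unfolding S_def using Cons.IH sum_list_boxes_Suc[where k = "length us" and M = M and J = J and
        F = "\<lambda>ns js. weight_prod (u # us) ns js * \<tau> ^ sum_list js"] by simp
qed

lemma sum_weak_comps_weight_prod_le:
  assumes u: "\<And>u n. u \<in> set us \<Longrightarrow> 0 \<le> u n" "\<And>u. u \<in> set us \<Longrightarrow> summable u" and \<tau>: "0 < \<tau>" "\<tau> < 1"
  shows "(\<Sum>N<M. \<Sum>(ns, js)\<in>weak_comps (length us) N J. weight_prod us ns js) \<le>
           (\<Prod>u\<leftarrow>us. suminf u * H 0 \<tau>) / \<tau> ^ J"
proof -
  let ?B = "{ns. set ns \<subseteq> {..<M} \<and> length ns = length us} \<times> {js. set js \<subseteq> {..J} \<and> length js = length us}"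
  have finB: "finite ?B" by (intro finite_cartesian_product finite_lists_length_eq) auto
  have "(\<Sum>N<M. \<Sum>(ns, js)\<in>weak_comps (length us) N J. weight_prod us ns js) * \<tau> ^ J =
      (\<Sum>N<M. \<Sum>(ns, js)\<in>weak_comps (length us) N J. weight_prod us ns js * \<tau> ^ sum_list js)"
    unfolding sum_distrib_right by (intro sum.cong) (auto simp: weak_comps_def)
  also have "\<dots> = (\<Sum>(ns, js)\<in>(\<Union>N\<in>{..<M}. weak_comps (length us) N J). weight_prod us ns js * \<tau> ^ sum_list js)"
    by (rule sum.UNION_disjoint[symmetric]) (simp, simp, force simp: weak_comps_def)
  also have "\<dots> \<le> (\<Sum>(ns, js)\<in>?B. weight_prod us ns js * \<tau> ^ sum_list js)"
  proof (rule sum_mono2[OF finB])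
    show "(\<Union>N\<in>{..<M}. weak_comps (length us) N J) \<subseteq> ?B"
      by (auto simp: weak_comps_def dest: member_le_sum_list)
  qed (use weight_prod_nonneg u \<tau> in auto)
  also have "\<dots> = (\<Prod>u\<leftarrow>us. (\<Sum>n<M. u n) * (\<Sum>j\<le>J. g j * \<tau> ^ j))"
    by (rule sum_boxes_weight_prod)
  also have "\<dots> \<le> (\<Prod>u\<leftarrow>us. suminf u * H 0 \<tau>)"
  proof -
    have g: "0 \<le> g j * \<tau> ^ j" for j using kap_pos[of 0 j] \<tau> by simp
    have G: "(\<Sum>j\<le>J. g j * \<tau> ^ j) \<le> H 0 \<tau>"
      unfolding H_def using \<tau> g by (intro sum_le_suminf summable_kap) auto
    show ?thesis
      using u
    proof (induction us)
      case (Cons u us)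
      have "(\<Sum>n<M. u n) \<le> suminf u" using Cons.prems by (intro sum_le_suminf) auto
      moreover have "0 \<le> (\<Sum>n<M. u n)" using Cons.prems by (intro sum_nonneg) auto
      moreover have "0 \<le> (\<Prod>u\<leftarrow>us. (\<Sum>n<M. u n) * (\<Sum>j\<le>J. g j * \<tau> ^ j))"
      proof (rule prod_list_nonneg, clarsimp)
        fix v assume "v \<in> set us"
        then have "0 \<le> (\<Sum>n<M. v n)" using Cons.prems by (intro sum_nonneg) auto
        then show "0 \<le> (\<Sum>n<M. v n) * (\<Sum>j\<le>J. g j * \<tau> ^ j)"
          by (rule mult_nonneg_nonneg[OF _ sum_nonneg[OF g]])
      qed
      moreover have "0 \<le> (\<Sum>j\<le>J. g j * \<tau> ^ j)" by (rule sum_nonneg[OF g])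
      moreover have "(\<Prod>u\<leftarrow>us. (\<Sum>n<M. u n) * (\<Sum>j\<le>J. g j * \<tau> ^ j)) \<le> (\<Prod>u\<leftarrow>us. suminf u * H 0 \<tau>)"
        using Cons by auto
      ultimately show ?case using G
        by (simp only: list.map prod_list.Cons) (intro mult_mono; simp)
    qed auto
  qed
  finally show ?thesis using \<tau> by (simp add: field_simps)
qed

lemma path_scalar_vac_weight_prod:
  assumes "length ns = L" "length js = L"
  shows "path_scalar (vac L) ns js * q ^ sum_list ns * y ^ sum_list ns =
     weight_prod (replicate L (\<lambda>n. g n * (q * y) ^ n)) ns js"
  using assms
proof (induction L arbitrary: ns js)
  case (Suc L)
  from Suc.prems obtain n ns' j js' where eq: "ns = n # ns'" "js = j # js'"
      "length ns' = L" "length js' = L"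
    by (metis length_Suc_conv)
  show ?case using Suc.IH[OF eq(3,4), symmetric]
    by (simp add: eq power_add power_mult_distrib mult_ac)
qed auto

lemma path_scalar_weight_prod:
  assumes "length ns = length U + L" "length js = length U + L"
  shows "path_scalar (U @ vac L) ns js * q ^ sum_list (drop (length U) ns) * y ^ sum_list ns =
     weight_prod (map (\<lambda>w n. factor_scalar w n * y ^ n) U @ replicate L (\<lambda>n. g n * (q * y) ^ n)) ns js"
  using assms
proof (induction U arbitrary: ns js)
  case Nil
  then show ?case using path_scalar_vac_weight_prod by simp
next
  case (Cons w U)
  from Cons.prems obtain n ns' j js' where eq: "ns = n # ns'" "js = j # js'"
      "length ns' = length U + L" "length js' = length U + L"
    by (metis length_Suc_conv length_Cons add_Suc)
  show ?case using Cons.IH[OF eq(3,4), symmetric]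
    by (simp add: eq power_add mult_ac)
qed

lemma mp_trace_coeff_eq:
  "mp_trace_coeff q \<mu> ws N = complex_of_real
     (\<Sum>(ns, js)\<in>weak_comps (length ws) N (csum ws). ptrace (path_poly ws ns js))"
  unfolding mp_trace_coeff_def weak_comps_def[symmetric] of_real_sum
  by (rule sum.cong) (auto simp: weak_comps_def k_trace_prod_term)

text \<open>The diagonal matrix element at the vacuum dominates the trace, because all other closed paths
  spend the block \<open>vac L\<close> on levels at least one.\<close>

lemma mp_trace_approx:
  assumes y: "0 < y" "y < 1" and \<tau>: "0 < \<tau>" "\<tau> < 1"
  shows "\<exists>C. \<forall>L. norm (mp_trace q \<mu> y (U @ vac L) -
      complex_of_real (foldr (mp_op y) (U @ vac L) vac_state 0)) \<le> C * (H 0 (q * y) * H 0 \<tau>) ^ L"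
proof -
  define D where "D = csum U"
  define K where "K = real (Suc D) / (q ^ Suc D * (1 - q))"
  have K: "0 \<le> K" using q by (simp add: K_def)
  define P where "P = (\<Prod>w\<leftarrow>U. k_factor y w 0 * H 0 \<tau>)"
  have qy: "0 \<le> q * y" "q * y < 1" using yq_bounds[of y 1] y by (auto simp: mult.commute)
  have "norm (mp_trace q \<mu> y (U @ vac L) - complex_of_real (foldr (mp_op y) (U @ vac L) vac_state 0))
      \<le> (K * P / \<tau> ^ D) * (H 0 (q * y) * H 0 \<tau>) ^ L" for L
  proof -
    define ws where "ws = U @ vac L"
    \<comment> \<open>The powers of q gained in \<open>ptrace_approx\<close> belong to the block
      only, so y becomes q y there and stays y in U.\<close>
    define us where "us = map (\<lambda>w n. factor_scalar w n * y ^ n) U @ replicate L (\<lambda>n. g n * (q * y) ^ n)"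
    have len: "length ws = length us" "length ws = length U + L" by (simp_all add: ws_def us_def)
    have cs: "csum ws = D" by (simp add: ws_def D_def sum_list_replicate)
    define e where "e = (\<lambda>N. (\<Sum>(ns, js)\<in>weak_comps (length ws) N (csum ws). ptrace (path_poly ws ns js)) * y ^ N
         - vac_column ws N 0 * y ^ N)"
    define b where "b = (\<lambda>N. K * (\<Sum>(ns, js)\<in>weak_comps (length us) N D. weight_prod us ns js))"
    have u0: "0 \<le> u n" if "u \<in> set us" for u n
      using that y q by (auto simp: us_def factor_scalar_nonneg less_imp_le[OF kap_pos])
    have us: "summable u" if "u \<in> set us" for u
    proof -
      have "summable (\<lambda>n. factor_scalar w n * y ^ n)" for w
        using k_factor_sums[of y w 0] y by (simp add: sums_iff)
      then show ?thesis using that summable_kap[of "q * y"] qy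
        by (auto simp: us_def split: if_splits)
    qed
    have eb: "norm (e N) \<le> b N" for N
    proof -
      have "e N = (\<Sum>(ns, js)\<in>weak_comps (length ws) N D. (ptrace (path_poly ws ns js) - path_value ws ns js 0) * y ^ N)"
        by (simp add: e_def vac_column_def cs sum_distrib_right case_prod_unfold left_diff_distrib sum_subtractf)
      also have "norm \<dots> \<le> (\<Sum>(ns, js)\<in>weak_comps (length ws) N D. K * weight_prod us ns js)"
      proof (rule sum_norm_le, clarify)
        fix ns js assume *: "(ns, js) \<in> weak_comps (length ws) N D"
        then have l: "length ns = length U + L" "length js = length U + L" and N: "N = sum_list ns"
          by (auto simp: weak_comps_def len(2))
        have "norm ((ptrace (path_poly ws ns js) - path_value ws ns js 0) * y ^ N) =
            \<bar>ptrace (path_poly ws ns js) - path_value ws ns js 0\<bar> * y ^ N"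
          using y by (simp add: abs_mult)
        also have "\<dots> \<le> K * (path_scalar ws ns js * q ^ sum_list (drop (length U) ns)) * y ^ N"
          using ptrace_approx[OF l] y unfolding ws_def K_def D_def by (intro mult_right_mono) auto
        also have "\<dots> = K * weight_prod us ns js"
          using path_scalar_weight_prod[OF l, of y] by (simp add: ws_def us_def N mult.assoc)
        finally show "norm ((ptrace (path_poly ws ns js) - path_value ws ns js 0) * y ^ N) \<le> K * weight_prod us ns js" .
      qed
      also have "\<dots> = b N" by (simp add: b_def sum_distrib_left len case_prod_unfold)
      finally show ?thesis .
    qed
    have b0: "0 \<le> b N" for N
      using eb[of N] norm_ge_zero order.trans by blast
    have "(\<Prod>u\<leftarrow>us. suminf u * H 0 \<tau>) = P * (H 0 (q * y) * H 0 \<tau>) ^ L"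
    proof -
      have "suminf (\<lambda>n. factor_scalar w n * y ^ n) = k_factor y w 0" for w
        using k_factor_sums[of y w 0] y by (simp add: sums_iff)
      then show ?thesis by (simp add: us_def P_def o_def H_def)
    qed
    moreover have "(\<Sum>N<M. \<Sum>(ns, js)\<in>weak_comps (length us) N D. weight_prod us ns js) \<le>
        (\<Prod>u\<leftarrow>us. suminf u * H 0 \<tau>) / \<tau> ^ D" for M
      by (rule sum_weak_comps_weight_prod_le) (use u0 us \<tau> in auto)
    ultimately have S: "(\<Sum>N<M. \<Sum>(ns, js)\<in>weak_comps (length us) N D. weight_prod us ns js) \<le>
        P * (H 0 (q * y) * H 0 \<tau>) ^ L / \<tau> ^ D" for M
      by simp
    have bs: "(\<Sum>N<M. b N) \<le> K * (P * (H 0 (q * y) * H 0 \<tau>) ^ L / \<tau> ^ D)" for M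
      unfolding b_def sum_distrib_left[symmetric] by (rule mult_left_mono[OF S K])
    have sb: "summable b" by (rule summableI_nonneg_bounded[OF b0 bs])
    have se: "summable e" by (rule summable_comparison_test'[OF sb eb])
    have "norm (suminf e) \<le> suminf b" by (rule norm_suminf_le[OF eb sb])
    also have "\<dots> \<le> K * (P * (H 0 (q * y) * H 0 \<tau>) ^ L / \<tau> ^ D)"
      by (rule suminf_le_const[OF sb bs])
    finally have ne: "norm (suminf e) \<le> K * P / \<tau> ^ D * (H 0 (q * y) * H 0 \<tau>) ^ L"
      by simp
    have c: "(\<lambda>N. vac_column ws N 0 * y ^ N) sums foldr (mp_op y) ws vac_state 0"
      using y by (intro vac_column_sums) auto
    \<comment> \<open>Error and vacuum element converge separately, which also shows that the series
      defining \<open>mp_trace\<close> converges.\<close>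
    have "(\<lambda>N. e N + vac_column ws N 0 * y ^ N) sums (suminf e + foldr (mp_op y) ws vac_state 0)"
      by (intro sums_add c summable_sums se)
    then have "(\<lambda>N. complex_of_real (e N + vac_column ws N 0 * y ^ N)) sums
        complex_of_real (suminf e + foldr (mp_op y) ws vac_state 0)"
      by (rule sums_of_real)
    also have "(\<lambda>N. complex_of_real (e N + vac_column ws N 0 * y ^ N)) =
        (\<lambda>N. mp_trace_coeff q \<mu> ws N * complex_of_real y ^ N)"
      by (simp add: e_def mp_trace_coeff_eq)
    finally have "mp_trace q \<mu> y ws = complex_of_real (suminf e + foldr (mp_op y) ws vac_state 0)"
      unfolding mp_trace_def by (simp add: sums_iff)
    then show ?thesis using ne by (simp add: ws_def)
  qed
  then show ?thesis by blast
qed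

end

section \<open>The common eigenvector\<close>

lemma sums_shift_power:
  fixes z :: real
  assumes "(\<lambda>n. c n * z ^ n) sums s"
  shows "(\<lambda>n. (if n = 0 then 0 else c (n - 1)) * z ^ n) sums (z * s)"
proof -
  have "(\<lambda>n. (\<lambda>n. (if n = 0 then 0 else c (n - 1)) * z ^ n) (Suc n)) sums (z * s)"
    using sums_mult[OF assms, of z] by (simp add: mult_ac)
  from sums_Suc[OF this] show ?thesis by simp
qed

context q_mu
begin

section \<open>Functional equations and the eigenvector\<close>

lemma q_Suc_neq_1: "1 - q * q ^ n \<noteq> 0"
  using q_pow_less_1[of n] by simp

lemma kap_Suc_mult: "kap a (Suc n) * (1 - q ^ Suc n) = kap a n * (1 - \<mu> * q ^ (a + n))"
  using q_Suc_neq_1[of n] by (simp add: kap_Suc)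

lemma kap_Suc_left_mult: "kap (Suc a) n * (1 - q ^ Suc a) = kap a n * (1 - \<mu> * q ^ (a + n))"
proof -
  have "kap (Suc a) n = kap a n * ((1 - \<mu> * q ^ (a + n)) / (1 - q ^ Suc a))"
    by (simp add: kap_def qpoch_Suc)
  then show ?thesis using q_Suc_neq_1[of a] by simp
qed

text \<open>The q-difference equation of (\<mu> z)_\<infinity>/(z)_\<infinity>; coefficientwise it
  is the recursion \<open>kap_Suc_mult\<close> for g.\<close>

lemma H_q_shift:
  assumes "\<bar>z\<bar> < 1"
  shows "(1 - z) * H 0 z = (1 - \<mu> * z) * H 0 (q * z)"
proof -
  have qz: "\<bar>q * z\<bar> < 1"
    using assms q mult_le_one[of q "\<bar>z\<bar>"] by (auto simp: abs_mult intro: order.strict_trans1[OF mult_left_le_one_le])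
  have l: "(\<lambda>n. g n * z ^ n - (if n = 0 then 0 else g (n - 1)) * z ^ n) sums (H 0 z - z * H 0 z)"
    by (intro sums_diff sums_shift_power H_sums assms)
  \<comment> \<open>Shifting a series in q z produces q z where z is wanted; \<mu>/q corrects
    this.\<close>
  have r: "(\<lambda>n. g n * (q * z) ^ n - \<mu> / q * ((if n = 0 then 0 else g (n - 1)) * (q * z) ^ n)) sums
      (H 0 (q * z) - \<mu> / q * (q * z * H 0 (q * z)))"
    by (intro sums_diff sums_mult sums_shift_power H_sums qz)
  have "g n * z ^ n - (if n = 0 then 0 else g (n - 1)) * z ^ n =
      g n * (q * z) ^ n - \<mu> / q * ((if n = 0 then 0 else g (n - 1)) * (q * z) ^ n)" for n
  proof (cases n)
    case (Suc k)
    have "g (Suc k) - g k = g (Suc k) * q ^ Suc k - \<mu> * g k * q ^ k"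
      using kap_Suc_mult[of 0 k] by (simp add: algebra_simps)
    then have "(g (Suc k) - g k) * z ^ Suc k = (g (Suc k) * q ^ Suc k - \<mu> * g k * q ^ k) * z ^ Suc k"
      by simp
    then show ?thesis using q by (simp add: Suc power_mult_distrib field_simps)
  qed simp
  then have "H 0 z - z * H 0 z = H 0 (q * z) - \<mu> / q * (q * z * H 0 (q * z))"
    using sums_unique2[OF l] r by simp
  then show ?thesis using q by (simp add: field_simps)
qed

text \<open>Passing from a to a + 1 removes the factor 1 - \<mu> q^a z from the numerator (\<mu> q^a
  z)_\<infinity>.\<close>

lemma H_Suc:
  assumes "\<bar>z\<bar> < 1"
  shows "(1 - q ^ Suc a) * (1 - \<mu> * q ^ a * z) * H (Suc a) z = (1 - \<mu> * q ^ a) * H a z"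
proof -
  let ?c = "\<mu> * q ^ a"
  have l: "(\<lambda>n. (1 - q ^ Suc a) * (kap (Suc a) n * z ^ n - ?c * ((if n = 0 then 0 else kap (Suc a) (n - 1)) * z ^ n)))
     sums ((1 - q ^ Suc a) * (H (Suc a) z - ?c * (z * H (Suc a) z)))"
    by (intro sums_diff sums_mult sums_shift_power H_sums assms)
  have r: "(\<lambda>n. (1 - ?c) * (kap a n * z ^ n)) sums ((1 - ?c) * H a z)"
    by (intro sums_mult H_sums assms)
  have "(1 - q ^ Suc a) * (kap (Suc a) n * z ^ n - ?c * ((if n = 0 then 0 else kap (Suc a) (n - 1)) * z ^ n)) =
      (1 - ?c) * (kap a n * z ^ n)" for n
  proof (cases n)
    case 0
    then show ?thesis using kap_Suc_left_mult[of a 0] by (simp add: mult_ac)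
  next
    case (Suc k)
    have "(1 - q ^ Suc a) * (kap (Suc a) (Suc k) - ?c * kap (Suc a) k) =
        kap a (Suc k) * (1 - \<mu> * q ^ (a + Suc k)) - ?c * (kap a k * (1 - \<mu> * q ^ (a + k)))"
      by (simp only: kap_Suc_left_mult[symmetric]) (simp add: algebra_simps)
    also have "\<dots> = (1 - ?c) * kap a (Suc k)"
      unfolding kap_Suc_mult[of a k, symmetric] by (simp add: algebra_simps power_add)
    finally have "(1 - q ^ Suc a) * (kap (Suc a) (Suc k) - ?c * kap (Suc a) k) * z ^ Suc k =
        (1 - ?c) * kap a (Suc k) * z ^ Suc k" by simp
    then show ?thesis by (simp only: Suc) (simp add: algebra_simps)
  qed
  then have "(1 - q ^ Suc a) * (H (Suc a) z - ?c * (z * H (Suc a) z)) = (1 - ?c) * H a z"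
    using sums_unique2[OF l] r by simp
  then show ?thesis by (simp add: algebra_simps)
qed

lemma mu_y_bounds: "0 \<le> y \<Longrightarrow> y < 1 \<Longrightarrow> 0 \<le> \<mu> * y" "0 \<le> y \<Longrightarrow> y < 1 \<Longrightarrow> \<mu> * y < 1"
  using mu mult_left_le_one_le[of y \<mu>] by auto

lemma H_qpoch:
  assumes "0 \<le> z" "z < 1"
  shows "H a z * qpoch q (\<mu> * z) a = kap a 0 * H 0 z"
proof (induction a)
  case (Suc a)
  have n: "1 - q ^ Suc a \<noteq> 0" using q_Suc_neq_1 by simp
  have "(1 - q ^ Suc a) * (H (Suc a) z * qpoch q (\<mu> * z) (Suc a)) =
      ((1 - q ^ Suc a) * (1 - \<mu> * q ^ a * z) * H (Suc a) z) * qpoch q (\<mu> * z) a"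
    by (simp add: qpoch_Suc mult_ac)
  also have "\<dots> = (1 - \<mu> * q ^ a) * (H a z * qpoch q (\<mu> * z) a)"
    using assms by (subst H_Suc) auto
  also have "\<dots> = (1 - q ^ Suc a) * (kap (Suc a) 0 * H 0 z)"
    using kap_Suc_left_mult[of a 0] by (simp add: Suc mult_ac)
  finally show ?case using n by simp
qed (simp add: kap_def)

lemma qpoch_add: "qpoch q z (i + a) = qpoch q z i * qpoch q (z * q ^ i) a"
  by (induction a) (simp_all add: qpoch_Suc power_add mult_ac)

lemma H_0_yq:
  assumes y: "0 \<le> y" "y < 1"
  shows "H 0 (y * q ^ i) * qpoch q (\<mu> * y) i = H 0 y * qpoch q y i"
proof (induction i)
  case (Suc i)
  let ?z = "y * q ^ i"
  have A: "(1 - \<mu> * ?z) * H 0 (q * ?z) = (1 - ?z) * H 0 ?z"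
    using H_q_shift[of ?z] yq_bounds[OF y, of i] by simp
  have B: "H 0 (y * q ^ Suc i) * qpoch q (\<mu> * y) (Suc i) =
      ((1 - \<mu> * ?z) * H 0 (q * ?z)) * qpoch q (\<mu> * y) i"
    by (simp add: qpoch_Suc mult_ac)
  have "H 0 (y * q ^ Suc i) * qpoch q (\<mu> * y) (Suc i) = (1 - ?z) * (H 0 y * qpoch q y i)"
    unfolding B A Suc[symmetric] by (rule mult.assoc)
  also have "\<dots> = H 0 y * qpoch q y (Suc i)" by (simp add: qpoch_Suc)
  finally show ?case .
qed simp

text \<open>The entries of all \<open>MA a\<close> at all levels are explicit multiples of the
  single number \<open>H 0 y\<close>. This reduces the eigenvalue equation to the finite identity
  \<open>q_Vandermonde\<close>.\<close>

lemma H_yq: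
  assumes y: "0 \<le> y" "y < 1"
  shows "H a (y * q ^ i) = kap a 0 * H 0 y * qpoch q y i / qpoch q (\<mu> * y) (a + i)"
proof -
  have "H a (y * q ^ i) * qpoch q (\<mu> * y) (i + a) =
      (H a (y * q ^ i) * qpoch q (\<mu> * (y * q ^ i)) a) * qpoch q (\<mu> * y) i"
    by (simp add: qpoch_add mult_ac)
  also have "\<dots> = kap a 0 * (H 0 (y * q ^ i) * qpoch q (\<mu> * y) i)"
    by (subst H_qpoch[OF yq_bounds[OF y]]) simp
  also have "\<dots> = kap a 0 * H 0 y * qpoch q y i" by (subst H_0_yq[OF y]) simp
  finally show ?thesis
    using qpoch_pos[OF mu_y_bounds[OF y], of "a + i"] by (simp add: field_simps add.commute)
qed

text \<open>The generating functions of both sides solve \<open>(1 - z) C(z) = (1 - \<mu> y z) C(q z)\<close>.\<close>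

lemma q_Vandermonde:
  "(\<Sum>i\<le>m. g (m - i) * y ^ (m - i) * (qpoch q y i / qpoch q q i)) = qpoch q (\<mu> * y) m / qpoch q q m"
proof -
  define A where "A = Abs_fps (\<lambda>n. g n * y ^ n)"
  define \<beta> where "\<beta> = (\<lambda>n. qpoch q y n / qpoch q q n)"
  define B where "B = Abs_fps \<beta>"
  \<comment> \<open>\<open>A'\<close> and \<open>B'\<close> are A(q z) and B(q z), so their product
    is C(q z).\<close>
  define A' where "A' = Abs_fps (\<lambda>n. q ^ n * fps_nth A (n))"
  define B' where "B' = Abs_fps (\<lambda>n. q ^ n * fps_nth B (n))"
  define C where "C = A * B"
  let ?X = "fps_X :: real fps"
  have nz: "1 - fps_const y * ?X \<noteq> 0"
  proof
    assume "1 - fps_const y * ?X = 0"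
    then have "fps_nth (1 - fps_const y * ?X) 0 = 0" by simp
    then show False by simp
  qed
  have qq: "qpoch q q n \<noteq> 0" for n using qpoch_pos[of q n] q by simp
  have a: "(1 - fps_const y * ?X) * A = (1 - fps_const (\<mu> * y) * ?X) * A'"
  proof (rule fps_ext)
    fix n show "fps_nth ((1 - fps_const y * ?X) * A) n = fps_nth ((1 - fps_const (\<mu> * y) * ?X) * A') n"
    proof (cases n)
      case (Suc k)
      have "g (Suc k) - g k = g (Suc k) * q ^ Suc k - \<mu> * g k * q ^ k"
        using kap_Suc_mult[of 0 k] by (simp add: algebra_simps)
      then have "(g (Suc k) - g k) * y ^ Suc k = (g (Suc k) * q ^ Suc k - \<mu> * g k * q ^ k) * y ^ Suc k"
        by simp
      then show ?thesis by (simp add: Suc A_def A'_def algebra_simps mult.assoc)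
    qed (simp add: A_def A'_def mult.assoc algebra_simps)
  qed
  have b: "(1 - ?X) * B = (1 - fps_const y * ?X) * B'"
  proof (rule fps_ext)
    fix n show "fps_nth ((1 - ?X) * B) n = fps_nth ((1 - fps_const y * ?X) * B') n"
    proof (cases n)
      case (Suc k)
      have "\<beta> (Suc k) * (1 - q ^ Suc k) = \<beta> k * (1 - y * q ^ k)"
        using qq[of k] q_Suc_neq_1[of k] by (simp add: qpoch_Suc \<beta>_def)
      then show ?thesis by (simp add: Suc B_def B'_def algebra_simps mult.assoc)
    qed (simp add: B_def B'_def mult.assoc algebra_simps)
  qed
  have c: "fps_nth (A' * B') n = q ^ n * fps_nth C (n)" for n
    by (simp add: fps_mult_nth A'_def B'_def C_def sum_distrib_left mult_ac flip: power_add)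
  have "(1 - fps_const y * ?X) * ((1 - ?X) * C) = ((1 - fps_const y * ?X) * A) * ((1 - ?X) * B)"
    by (simp add: C_def mult_ac)
  also have "\<dots> = (1 - fps_const y * ?X) * ((1 - fps_const (\<mu> * y) * ?X) * (A' * B'))"
    unfolding a b by (simp add: mult_ac)
  finally have eq: "(1 - ?X) * C = (1 - fps_const (\<mu> * y) * ?X) * (A' * B')"
    using nz by simp
  have "fps_nth C (n) = qpoch q (\<mu> * y) n / qpoch q q n" for n
  proof (induction n)
    case 0
    show ?case by (simp add: C_def A_def B_def \<beta>_def)
  next
    case (Suc n)
    from arg_cong[OF eq, of "\<lambda>f. fps_nth f (Suc n)"]
    have "fps_nth C (Suc n) * (1 - q ^ Suc n) = fps_nth C (n) * (1 - \<mu> * y * q ^ n)"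
      by (simp add: c left_diff_distrib mult.assoc) (simp add: c algebra_simps)
    then show ?case using Suc q_Suc_neq_1[of n] qq by (simp add: qpoch_Suc field_simps)
  qed
  moreover have "C = B * A" by (simp add: C_def mult.commute)
  ultimately have "fps_nth (B * A) m = qpoch q (\<mu> * y) m / qpoch q q m" by simp
  then show ?thesis
    by (subst (asm) fps_mult_nth) (simp add: A_def B_def \<beta>_def atLeast0AtMost mult_ac)
qed

lemma cprod_Suc_Suc: "cprod q (Suc l) (Suc a) = (1 - q ^ Suc l) * cprod q l a"
  by (simp add: cprod_def prod.lessThan_Suc_shift del: prod.lessThan_Suc)

lemma cprod_qpoch: "cprod q (a + i) a * qpoch q q i = qpoch q q (a + i)"
proof (induction a)
  case (Suc a)
  then show ?case by (simp add: cprod_Suc_Suc qpoch_Suc mult_ac)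
qed simp

text \<open>Levels below \<open>num_c w\<close> are annihilated by the c's, so the sum can run over
  the level i reached after them.\<close>

lemma mp_op_altdef:
  "mp_op y w x m = (\<Sum>i\<le>m. k_factor y w i * (cprod q (num_c w + i) (num_c w) * g (m - i)) * x (num_c w + i))"
proof -
  let ?a = "num_c w"
  have "mp_op y w x m = (\<Sum>l\<in>(+) ?a ` {..m}. k_factor y w (l - ?a) * (cprod q l ?a * g (m + ?a - l)) * x l)"
    unfolding mp_op_def
  proof (rule sum.mono_neutral_right)
    show "\<forall>l\<in>{..m + ?a} - (+) ?a ` {..m}. k_factor y w (l - ?a) * (cprod q l ?a * g (m + ?a - l)) * x l = 0"
    proof
      fix l assume l: "l \<in> {..m + ?a} - (+) ?a ` {..m}"
      have "l < ?a"
      proof (rule ccontr)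
        assume "\<not> l < ?a"
        then have "l = ?a + (l - ?a)" "l - ?a \<le> m" using l by auto
        then show False using l by blast
      qed
      then show "k_factor y w (l - ?a) * (cprod q l ?a * g (m + ?a - l)) * x l = 0"
        by (simp add: cprod_eq_0)
    qed
  qed auto
  then show ?thesis by (simp add: sum.reindex)
qed

definition eigvec :: "real \<Rightarrow> nat \<Rightarrow> real" where
  "eigvec y m = qpoch q (\<mu> * y) m / (y ^ m * qpoch q q m)"

definition eigval :: "real \<Rightarrow> nat \<Rightarrow> real" where
  "eigval y a = kap a 0 / y ^ a * H 0 y"

text \<open>All operators \<open>A\<^sub>a\<close> share one eigenvector, the expansion of \<open>(\<mu> b)\<^sub>\<infinity> / (b / y)\<^sub>\<infinity> |0\<rangle>\<close>.\<close>

lemma mp_op_eigvec: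
  assumes y: "0 < y" "y < 1"
  shows "mp_op y (MA a) (eigvec y) m = eigval y a * eigvec y m"
proof -
  have qq: "qpoch q q n \<noteq> 0" for n using qpoch_pos[of q n] q by simp
  have my: "qpoch q (\<mu> * y) n \<noteq> 0" for n using qpoch_pos[OF mu_y_bounds, of y n] y by simp
  have "mp_op y (MA a) (eigvec y) m =
      (\<Sum>i\<le>m. eigval y a / y ^ m * (g (m - i) * y ^ (m - i) * (qpoch q y i / qpoch q q i)))"
    unfolding mp_op_altdef
  proof (rule sum.cong)
    fix i assume i: "i \<in> {..m}"
    have c: "cprod q (a + i) a = qpoch q q (a + i) / qpoch q q i"
      using cprod_qpoch[of a i] qq[of i] by (simp add: field_simps)
    have ym: "y ^ m = y ^ (m - i) * y ^ i" using i by (simp flip: power_add)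
    show "k_factor y (MA a) i * (cprod q (num_c (MA a) + i) (num_c (MA a)) * g (m - i)) * eigvec y (num_c (MA a) + i) =
        eigval y a / y ^ m * (g (m - i) * y ^ (m - i) * (qpoch q y i / qpoch q q i))"
      using H_yq[of y a i] y my[of "a + i"] qq[of "a + i"] qq[of i]
      by (simp add: c eigvec_def eigval_def ym power_add) (simp add: field_simps)
  qed simp
  also have "\<dots> = eigval y a / y ^ m * (qpoch q (\<mu> * y) m / qpoch q q m)"
    by (simp only: q_Vandermonde flip: sum_distrib_left)
  finally show ?thesis by (simp add: eigvec_def)
qed

section \<open>Linearity and geometric bounds for products of operators\<close>

lemma mp_op_lincomb:
  "mp_op y w (\<lambda>m. c * x m + d * z m) m = c * mp_op y w x m + d * mp_op y w z m"
  by (simp add: mp_op_def sum_distrib_left sum.distrib algebra_simps)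

lemma foldr_mp_op_lincomb:
  "foldr (mp_op y) U (\<lambda>m. c * x m + d * z m) m = c * foldr (mp_op y) U x m + d * foldr (mp_op y) U z m"
proof (induction U arbitrary: m)
  case (Cons w U)
  have "foldr (mp_op y) U (\<lambda>m. c * x m + d * z m) =
      (\<lambda>m. c * foldr (mp_op y) U x m + d * foldr (mp_op y) U z m)"
    using Cons by blast
  then show ?case by (simp add: mp_op_lincomb)
qed simp

lemma foldr_mp_op_scale: "foldr (mp_op y) U (\<lambda>m. c * x m) m = c * foldr (mp_op y) U x m"
  using foldr_mp_op_lincomb[of y U c x 0 x m] by simp

lemma foldr_mp_op_eigvec:
  assumes y: "0 < y" "y < 1"
  shows "foldr (mp_op y) (map MA as) (eigvec y) m = prod_list (map (eigval y) as) * eigvec y m"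
proof (induction as arbitrary: m)
  case (Cons a as)
  then have "foldr (mp_op y) (map MA as) (eigvec y) = (\<lambda>m. prod_list (map (eigval y) as) * eigvec y m)"
    by blast
  then show ?case
    using foldr_mp_op_scale[of y "[MA a]" "prod_list (map (eigval y) as)" "eigvec y" m] mp_op_eigvec[OF y]
    by (simp add: mult_ac)
qed simp

lemma eigvec_0 [simp]: "eigvec y 0 = 1"
  by (simp add: eigvec_def)

lemma eigval_0: "eigval y 0 = H 0 y"
  by (simp add: eigval_def)

lemma eigval_pos: "0 < y \<Longrightarrow> y < 1 \<Longrightarrow> 0 < eigval y a"
  by (auto simp: eigval_def intro!: mult_pos_pos divide_pos_pos kap_pos H_pos)

text \<open>The constant may depend on the component m. Since rows are finite, this weak notion is
  still preserved by every \<open>mp_op\<close>.\<close>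

definition geo_bounded :: "real \<Rightarrow> (nat \<Rightarrow> nat \<Rightarrow> real) \<Rightarrow> bool" where
  "geo_bounded b X \<longleftrightarrow> (\<forall>m. \<exists>C. \<forall>n. \<bar>X n m\<bar> \<le> C * b ^ n)"

lemma geo_bounded_mp_op:
  assumes "geo_bounded b X"
  shows "geo_bounded b (\<lambda>n. mp_op y w (X n))"
  unfolding geo_bounded_def
proof
  fix m
  from assms obtain C where C: "\<And>l n. \<bar>X n l\<bar> \<le> C l * b ^ n"
    unfolding geo_bounded_def by metis
  define c where "c = (\<lambda>l. k_factor y w (l - num_c w) * (cprod q l (num_c w) * g (m + num_c w - l)))"
  have "\<bar>mp_op y w (X n) m\<bar> \<le> (\<Sum>l\<le>m + num_c w. \<bar>c l\<bar> * C l) * b ^ n" for n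
  proof -
    have "\<bar>mp_op y w (X n) m\<bar> \<le> (\<Sum>l\<le>m + num_c w. \<bar>c l * X n l\<bar>)"
      unfolding mp_op_def c_def by (rule sum_abs)
    also have "\<dots> \<le> (\<Sum>l\<le>m + num_c w. \<bar>c l\<bar> * (C l * b ^ n))"
      unfolding abs_mult by (intro sum_mono mult_left_mono C) auto
    finally show ?thesis by (simp add: sum_distrib_right mult.assoc)
  qed
  then show "\<exists>C. \<forall>n. \<bar>mp_op y w (X n) m\<bar> \<le> C * b ^ n" by blast
qed

lemma geo_bounded_foldr:
  "geo_bounded b X \<Longrightarrow> geo_bounded b (\<lambda>n. foldr (mp_op y) U (X n))"
  by (induction U) (auto intro: geo_bounded_mp_op)

lemma mp_op_MA_0: "mp_op y (MA 0) x m = (\<Sum>i\<le>m. H 0 (y * q ^ i) * g (m - i) * x i)"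
  by (simp add: mp_op_altdef)

text \<open>On the levels above the vacuum, \<open>A\<^sub>0\<close> is bounded by \<open>H 0 (q * y) * H 0 \<tau>\<close> with respect to the
  weighted supremum norm with weights \<open>\<tau> ^ m\<close>.\<close>

lemma geo_bounded_vac:
  assumes y: "0 < y" "y < 1" and \<tau>: "0 < \<tau>" "\<tau> < 1" and x: "x 0 = 0"
  shows "geo_bounded (H 0 (q * y) * H 0 \<tau>) (\<lambda>n. foldr (mp_op y) (vac n) x)"
  unfolding geo_bounded_def
proof
  fix M
  define b where "b = H 0 (q * y) * H 0 \<tau>"
  \<comment> \<open>\<open>MA 0\<close> is lower triangular, so the components up to M evolve among
    themselves and a finite maximum suffices.\<close>
  define C where "C = Max ((\<lambda>i. \<bar>x i\<bar> * \<tau> ^ i) ` {..M})"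
  have qy: "0 \<le> q * y" "q * y < 1" using yq_bounds[of y 1] y by (auto simp: mult.commute)
  have pos: "0 < H 0 (q * y)" "0 < H 0 \<tau>" using qy \<tau> by (auto intro: H_pos)
  have C: "\<bar>x i\<bar> * \<tau> ^ i \<le> C" if "i \<le> M" for i
    using that by (auto simp: C_def)
  have "foldr (mp_op y) (vac n) x 0 = 0 \<and>
      (\<forall>m\<le>M. \<bar>foldr (mp_op y) (vac n) x m\<bar> * \<tau> ^ m \<le> C * b ^ n)" for n
  proof (induction n)
    case (Suc n)
    define z where "z = foldr (mp_op y) (vac n) x"
    have z0: "z 0 = 0" and z: "\<And>m. m \<le> M \<Longrightarrow> \<bar>z m\<bar> * \<tau> ^ m \<le> C * b ^ n"
      using Suc by (auto simp: z_def)
    have C0: "0 \<le> C * b ^ n" using z[of 0] z0 by simp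
    have "\<bar>mp_op y (MA 0) z m\<bar> * \<tau> ^ m \<le> C * b ^ Suc n" if m: "m \<le> M" for m
    proof -
      have "\<bar>H 0 (y * q ^ i) * g (m - i) * z i\<bar> * \<tau> ^ m \<le> H 0 (q * y) * (g (m - i) * \<tau> ^ (m - i)) * (C * b ^ n)"
        if i: "i \<le> m" for i
      proof (cases i)
        \<comment> \<open>The only place where the large entry \<open>H 0 y\<close> could enter; the
          vacuum component is 0 and stays 0.\<close>
        case 0
        then show ?thesis using z0 C0 pos \<tau> kap_pos[of 0 m] by simp
      next
        case (Suc k)
        have "q ^ k \<le> 1" using q by (intro power_le_one) auto
        then have "y * q ^ i \<le> q * y" using y q by (simp add: Suc mult.commute mult_left_le)
        then have h: "H 0 (y * q ^ i) \<le> H 0 (q * y)"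
          using yq_bounds[of y i] y qy by (intro H_mono) auto
        have h0: "0 < H 0 (y * q ^ i)" using yq_bounds[of y i] y by (intro H_pos) auto
        have tm: "\<tau> ^ m = \<tau> ^ (m - i) * \<tau> ^ i" using i by (simp flip: power_add)
        have "\<bar>H 0 (y * q ^ i) * g (m - i) * z i\<bar> * \<tau> ^ m =
            H 0 (y * q ^ i) * (g (m - i) * \<tau> ^ (m - i)) * (\<bar>z i\<bar> * \<tau> ^ i)"
          using h0 kap_pos[of 0 "m - i"] by (simp add: abs_mult tm)
        also have "\<dots> \<le> H 0 (q * y) * (g (m - i) * \<tau> ^ (m - i)) * (C * b ^ n)"
          by (rule mult_mono[OF mult_right_mono[OF h] z])
             (use i m pos \<tau> less_imp_le[OF kap_pos] in auto)
        finally show ?thesis .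
      qed
      then have "(\<Sum>i\<le>m. \<bar>H 0 (y * q ^ i) * g (m - i) * z i\<bar> * \<tau> ^ m) \<le>
          (\<Sum>i\<le>m. H 0 (q * y) * (g (m - i) * \<tau> ^ (m - i)) * (C * b ^ n))"
        by (intro sum_mono) auto
      also have "\<dots> = H 0 (q * y) * (\<Sum>i\<le>m. g (m - i) * \<tau> ^ (m - i)) * (C * b ^ n)"
        by (simp add: sum_distrib_left sum_distrib_right)
      also have "(\<Sum>i\<le>m. g (m - i) * \<tau> ^ (m - i)) = (\<Sum>i\<le>m. g i * \<tau> ^ i)"
        by (rule sum.reindex_bij_witness[of _ "\<lambda>i. m - i" "\<lambda>i. m - i"]) auto
      also have "H 0 (q * y) * (\<Sum>i\<le>m. g i * \<tau> ^ i) * (C * b ^ n) \<le> H 0 (q * y) * H 0 \<tau> * (C * b ^ n)"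
      proof (intro mult_right_mono mult_left_mono C0)
        show "(\<Sum>i\<le>m. g i * \<tau> ^ i) \<le> H 0 \<tau>"
          unfolding H_def using \<tau> kap_pos by (intro sum_le_suminf summable_kap) (auto intro: less_imp_le)
      qed (use pos in auto)
      finally have "(\<Sum>i\<le>m. \<bar>H 0 (y * q ^ i) * g (m - i) * z i\<bar> * \<tau> ^ m) \<le> C * b ^ Suc n"
        by (simp add: b_def mult_ac)
      moreover have "\<bar>mp_op y (MA 0) z m\<bar> * \<tau> ^ m \<le> (\<Sum>i\<le>m. \<bar>H 0 (y * q ^ i) * g (m - i) * z i\<bar>) * \<tau> ^ m"
        unfolding mp_op_MA_0 using \<tau> by (intro mult_right_mono sum_abs) auto
      ultimately show ?thesis by (simp add: sum_distrib_right)
    qed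
    moreover have "mp_op y (MA 0) z 0 = 0" by (simp add: mp_op_MA_0 z0)
    ultimately show ?case by (simp add: z_def)
  qed (use x C in auto)
  then have "\<bar>foldr (mp_op y) (vac n) x M\<bar> \<le> C / \<tau> ^ M * b ^ n" for n
    using \<tau> by (auto simp: field_simps)
  then show "\<exists>C. \<forall>n. \<bar>foldr (mp_op y) (vac n) x M\<bar> \<le> C * (H 0 (q * y) * H 0 \<tau>) ^ n"
    unfolding b_def by blast
qed

section \<open>The spectral gap and the limit of the traces\<close>

lemma H_has_derivative:
  assumes "\<bar>z\<bar> < 1"
  shows "(H a has_field_derivative deriv (H a) z) (at z)"
    "(\<lambda>n. real n * (kap a n * z ^ n)) sums (z * deriv (H a) z)"
proof -
  obtain K where K: "\<bar>z\<bar> < K" "K < 1" using assms dense by blast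
  have sK: "summable (\<lambda>n. kap a n * K ^ n)" using K by (intro summable_kap) auto
  have D: "(H a has_field_derivative (\<Sum>n. diffs (kap a) n * z ^ n)) (at z)"
    using termdiffs_strong[OF sK, of z] K unfolding H_def by simp
  then have e: "deriv (H a) z = (\<Sum>n. diffs (kap a) n * z ^ n)" by (rule DERIV_imp_deriv)
  show "(H a has_field_derivative deriv (H a) z) (at z)" using D e by simp
  have "summable (\<lambda>n. diffs (kap a) n * z ^ n)"
    by (rule termdiff_converges[of z 1]) (use assms summable_kap in auto)
  then have "(\<lambda>n. of_nat n * kap a n * z ^ (n - Suc 0)) sums (\<Sum>n. diffs (kap a) n * z ^ n)"
    by (rule diffs_equiv)
  then have "(\<lambda>n. z * (of_nat n * kap a n * z ^ (n - Suc 0))) sums (z * deriv (H a) z)"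
    unfolding e by (rule sums_mult)
  also have "(\<lambda>n. z * (of_nat n * kap a n * z ^ (n - Suc 0))) = (\<lambda>n. real n * (kap a n * z ^ n))"
  proof
    fix n show "z * (of_nat n * kap a n * z ^ (n - Suc 0)) = real n * (kap a n * z ^ n)"
      by (cases n) auto
  qed
  finally show "(\<lambda>n. real n * (kap a n * z ^ n)) sums (z * deriv (H a) z)" .
qed

text \<open>By \<open>H_q_shift\<close>, H(q y)/H(y) = (1 - y)/(1 - \<mu> y), which is below 1
  because \<mu> < 1. As \<open>H 0\<close> is continuous at 0 with value 1, a small \<tau> preserves
  the strict inequality.\<close>

lemma exists_gap:
  assumes y: "0 < y" "y < 1"
  shows "\<exists>\<tau>. 0 < \<tau> \<and> \<tau> < 1 \<and> H 0 (q * y) * H 0 \<tau> < H 0 y"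
proof -
  have "\<mu> * y < y" using mu y by simp
  then have 1: "1 - y < 1 - \<mu> * y" by simp
  have qy: "0 \<le> q * y" "q * y < 1" using yq_bounds[of y 1] y by (auto simp: mult.commute)
  have pos: "0 < H 0 (q * y)" using qy by (rule H_pos)
  have "(1 - y) * H 0 (q * y) < (1 - \<mu> * y) * H 0 (q * y)" using 1 pos by simp
  also have "\<dots> = (1 - y) * H 0 y" using H_q_shift[of y] y by simp
  finally have lt: "H 0 (q * y) < H 0 y" using y by simp
  have H00: "H 0 0 = 1" by (simp add: H_def powser_zero[of "kap 0"])
  have "isCont (H 0) 0" using H_has_derivative(1)[of 0 0] by (intro DERIV_isCont) auto
  then have "H 0 \<midarrow>0\<rightarrow> 1" by (simp add: isCont_def H00)
  then have "((\<lambda>\<tau>. H 0 (q * y) * H 0 \<tau>) \<longlongrightarrow> H 0 (q * y) * 1) (at_right 0)"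
    by (intro tendsto_intros filterlim_mono[OF \<open>H 0 \<midarrow>0\<rightarrow> 1\<close>]) (auto simp: at_le)
  then have "\<forall>\<^sub>F \<tau> in at_right 0. H 0 (q * y) * H 0 \<tau> < H 0 y"
    by (rule order_tendstoD) (use lt in simp)
  moreover have "\<forall>\<^sub>F \<tau> in at_right 0. \<tau> \<in> {0<..<1 :: real}"
    by (rule eventually_at_right_real) simp
  ultimately have "\<forall>\<^sub>F \<tau> in at_right 0. 0 < \<tau> \<and> \<tau> < 1 \<and> H 0 (q * y) * H 0 \<tau> < H 0 y"
    by eventually_elim auto
  then show ?thesis using eventually_happens'[of "at_right (0 :: real)"] by simp
qed

lemma mp_trace_tendsto:
  assumes y: "0 < y" "y < 1"
  shows "(\<lambda>L. mp_trace q \<mu> y (U @ vac L) / complex_of_real (H 0 y ^ L)) \<longlonglongrightarrow>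
     complex_of_real (foldr (mp_op y) U (eigvec y) 0)"
proof -
  obtain \<tau> where \<tau>: "0 < \<tau>" "\<tau> < 1" "H 0 (q * y) * H 0 \<tau> < H 0 y" using exists_gap[OF y] by blast
  define b where "b = H 0 (q * y) * H 0 \<tau>"
  define h where "h = H 0 y"
  have qy: "0 \<le> q * y" "q * y < 1" using yq_bounds[of y 1] y by (auto simp: mult.commute)
  have b: "0 \<le> b" "b < h" using \<tau> qy less_imp_le[OF H_pos] by (auto simp: b_def h_def)
  obtain C1 where C1: "\<And>L. norm (mp_trace q \<mu> y (U @ vac L) -
      complex_of_real (foldr (mp_op y) (U @ vac L) vac_state 0)) \<le> C1 * b ^ L"
    using mp_trace_approx[OF y \<tau>(1,2), of U] unfolding b_def by blast
  \<comment> \<open>The vacuum is the eigenvector plus x. The block multiplies the eigenvector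
    exactly by h^L; since \<open>eigvec y 0\<close> is 1, x has no vacuum component and grows at
    most like b^L with b < h.\<close>
  define x where "x = (\<lambda>m. 1 * vac_state m + (- 1) * eigvec y m)"
  have "geo_bounded b (\<lambda>L. foldr (mp_op y) U (foldr (mp_op y) (vac L) x))"
    unfolding b_def by (intro geo_bounded_foldr geo_bounded_vac y \<tau>) (simp add: x_def)
  then obtain C2 where C2: "\<And>L. \<bar>foldr (mp_op y) U (foldr (mp_op y) (vac L) x) 0\<bar> \<le> C2 * b ^ L"
    unfolding geo_bounded_def by blast
  have xL: "foldr (mp_op y) U (foldr (mp_op y) (vac L) x) 0 =
      foldr (mp_op y) (U @ vac L) vac_state 0 - h ^ L * foldr (mp_op y) U (eigvec y) 0" for L
  proof -
    have "foldr (mp_op y) (U @ vac L) (eigvec y) 0 = foldr (mp_op y) U (\<lambda>m. h ^ L * eigvec y m) 0"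
    proof -
      have "foldr (mp_op y) (vac L) (eigvec y) = (\<lambda>m. h ^ L * eigvec y m)"
        using foldr_mp_op_eigvec[OF y, of "replicate L 0"] by (auto simp: eigval_0 h_def)
      then show ?thesis by simp
    qed
    then show ?thesis
      using foldr_mp_op_lincomb[of y "U @ vac L" 1 vac_state "- 1" "eigvec y" 0]
      by (simp add: x_def foldr_mp_op_scale)
  qed
  have bound: "norm (mp_trace q \<mu> y (U @ vac L) / complex_of_real (h ^ L) -
      complex_of_real (foldr (mp_op y) U (eigvec y) 0)) \<le> (C1 + C2) * (b / h) ^ L" for L
  proof -
    have hL: "0 < h ^ L" using b by simp
    have "norm (mp_trace q \<mu> y (U @ vac L) - complex_of_real (h ^ L * foldr (mp_op y) U (eigvec y) 0)) \<le>
        C1 * b ^ L + C2 * b ^ L"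
    proof -
      have "mp_trace q \<mu> y (U @ vac L) - complex_of_real (h ^ L * foldr (mp_op y) U (eigvec y) 0) =
          (mp_trace q \<mu> y (U @ vac L) - complex_of_real (foldr (mp_op y) (U @ vac L) vac_state 0)) +
          complex_of_real (foldr (mp_op y) U (foldr (mp_op y) (vac L) x) 0)"
        unfolding xL by simp
      then show ?thesis
        using C1[of L] C2[of L] by (simp only: norm_triangle_le[OF add_mono] norm_of_real)
    qed
    moreover have "mp_trace q \<mu> y (U @ vac L) / complex_of_real (h ^ L) -
        complex_of_real (foldr (mp_op y) U (eigvec y) 0) =
        (mp_trace q \<mu> y (U @ vac L) - complex_of_real (h ^ L * foldr (mp_op y) U (eigvec y) 0)) /
          complex_of_real (h ^ L)"
      using b by (simp add: diff_divide_distrib)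
    ultimately show ?thesis
      using hL b by (simp add: norm_divide power_divide divide_right_mono norm_power flip: distrib_right)
  qed
  have "(\<lambda>L. (C1 + C2) * (b / h) ^ L) \<longlonglongrightarrow> 0"
    using b by (intro tendsto_mult_right_zero LIMSEQ_realpow_zero) auto
  then have "(\<lambda>L. mp_trace q \<mu> y (U @ vac L) / complex_of_real (h ^ L) -
      complex_of_real (foldr (mp_op y) U (eigvec y) 0)) \<longlonglongrightarrow> 0"
    by (rule Lim_null_comparison[rotated]) (use bound in auto)
  then show ?thesis unfolding h_def by (rule LIM_zero_cancel)
qed

end

section \<open>Densities\<close>

context q_mu
begin

definition logd :: "real \<Rightarrow> real" where
  "logd z = z * deriv (H 0) z / H 0 z"

text \<open>The logarithmic derivative of \<open>H_q_shift\<close>: the last term is z/(1 - z) -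
  \<mu> z/(1 - \<mu> z).\<close>

lemma logd_step:
  assumes z: "0 \<le> z" "z < 1"
  shows "logd z = logd (q * z) + (1 - \<mu>) * z / ((1 - z) * (1 - \<mu> * z))"
proof -
  have qz: "0 \<le> q * z" "q * z < 1" using yq_bounds[of z 1] z by (auto simp: mult.commute)
  have L: "((\<lambda>z. (1 - z) * H 0 z) has_field_derivative (1 - z) * deriv (H 0) z - H 0 z) (at z)"
    using z by (auto intro!: derivative_eq_intros H_has_derivative(1))
  have C: "((\<lambda>z. H 0 (q * z)) has_field_derivative deriv (H 0) (q * z) * q) (at z)"
  proof (rule DERIV_chain2[where f = "H 0" and g = "\<lambda>z. q * z"])
    show "(H 0 has_field_derivative deriv (H 0) (q * z)) (at (q * z))"
      using qz by (intro H_has_derivative(1)) auto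
  qed (auto intro!: derivative_eq_intros)
  have "((\<lambda>z. (1 - \<mu> * z) * H 0 (q * z)) has_field_derivative
      (1 - \<mu> * z) * (deriv (H 0) (q * z) * q) - \<mu> * H 0 (q * z)) (at z)"
    by (auto intro!: derivative_eq_intros C)
  then have "((\<lambda>z. (1 - z) * H 0 z) has_field_derivative
      (1 - \<mu> * z) * (deriv (H 0) (q * z) * q) - \<mu> * H 0 (q * z)) (at z)"
    \<comment> \<open>The functional equation holds on an open interval that also surrounds z =
      0.\<close>
    by (rule has_field_derivative_transform_within_open[of _ _ _ "{-1<..<1}"])
       (use z H_q_shift in auto)
  with L have D: "(1 - z) * deriv (H 0) z - H 0 z =
      (1 - \<mu> * z) * (deriv (H 0) (q * z) * q) - \<mu> * H 0 (q * z)"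
    by (rule DERIV_unique)
  have pos: "0 < H 0 z" "0 < H 0 (q * z)" "0 < 1 - z" "0 < 1 - \<mu> * z"
    using z qz mu_y_bounds[of z] by (auto intro: H_pos)
  have S: "(1 - z) * H 0 z = (1 - \<mu> * z) * H 0 (q * z)" using z by (intro H_q_shift) auto
  define A where "A = deriv (H 0) z"
  define B where "B = deriv (H 0) (q * z) * q"
  define h where "h = H 0 z"
  define k where "k = H 0 (q * z)"
  have D': "(1 - z) * A = h - \<mu> * k + (1 - \<mu> * z) * B" using D unfolding A_def B_def h_def k_def by linarith
  have k: "k = (1 - z) * h / (1 - \<mu> * z)" using S pos by (simp add: h_def k_def field_simps)
  have "A / h - B / k = (1 - \<mu>) / ((1 - z) * (1 - \<mu> * z))"
  proof -
    have "A / h = ((1 - z) * A) / ((1 - z) * h)" using pos by simp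
    also have "\<dots> = (h - \<mu> * k + (1 - \<mu> * z) * B) / ((1 - z) * h)" by (simp only: D')
    also have "\<dots> = (h - \<mu> * k) / ((1 - z) * h) + (1 - \<mu> * z) * B / ((1 - \<mu> * z) * k)"
      using S by (simp only: add_divide_distrib h_def k_def)
    also have "(1 - \<mu> * z) * B / ((1 - \<mu> * z) * k) = B / k" using pos by simp
    also have "(h - \<mu> * k) / ((1 - z) * h) = (1 - \<mu>) / ((1 - z) * (1 - \<mu> * z))"
    proof -
      have "h - \<mu> * k = (1 - \<mu>) * h / (1 - \<mu> * z)"
        using pos unfolding k by (simp add: field_simps)
      moreover have "h \<noteq> 0" using pos by (simp add: h_def)
      ultimately show ?thesis by (simp add: mult_ac)
    qed
    finally show ?thesis by simp
  qed
  then have "z * (A / h) = z * (B / k + (1 - \<mu>) / ((1 - z) * (1 - \<mu> * z)))" by (simp add: diff_eq_eq)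
  then show ?thesis
    by (simp add: logd_def A_def B_def h_def k_def distrib_left mult_ac)
qed

text \<open>The series of z times the derivative of \<open>H 0\<close> has no constant term, so
  replacing y by y q^n gains at least a factor q^n in every term, while the denominator of
  \<open>logd\<close> is at least 1.\<close>

lemma logd_bounds:
  assumes y: "0 \<le> y" "y < 1"
  shows "0 \<le> logd (y * q ^ n)" "logd (y * q ^ n) \<le> q ^ n * (y * deriv (H 0) y)"
proof -
  let ?z = "y * q ^ n"
  note z = yq_bounds[OF y, of n]
  have D: "(\<lambda>k. real k * (g k * ?z ^ k)) sums (?z * deriv (H 0) ?z)"
    using z by (intro H_has_derivative) auto
  have Dy: "(\<lambda>k. real k * (g k * y ^ k)) sums (y * deriv (H 0) y)"
    using y by (intro H_has_derivative) auto
  have nn: "0 \<le> real k * (g k * ?z ^ k)" for k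
    using z less_imp_le[OF kap_pos[of 0 k]] by simp
  have D0: "0 \<le> ?z * deriv (H 0) ?z"
    using suminf_nonneg[of "\<lambda>k. real k * (g k * ?z ^ k)"] D nn by (simp add: sums_iff)
  have H1: "1 \<le> H 0 ?z" using H_ge[OF z, of 0] by simp
  show "0 \<le> logd ?z" using D0 H1 by (simp add: logd_def)
  have le: "real k * (g k * ?z ^ k) \<le> q ^ n * (real k * (g k * y ^ k))" for k
  proof (cases k)
    case (Suc j)
    have "(q ^ n) ^ k \<le> q ^ n"
      using q_pow[of n] q by (simp add: Suc power_le_one mult_left_le)
    then have "real k * (g k * y ^ k) * (q ^ n) ^ k \<le> real k * (g k * y ^ k) * q ^ n"
      using y less_imp_le[OF kap_pos[of 0 k]] by (intro mult_left_mono) auto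
    then show ?thesis by (simp add: power_mult_distrib mult_ac)
  qed simp
  have "?z * deriv (H 0) ?z \<le> q ^ n * (y * deriv (H 0) y)"
    by (rule sums_le[OF le D sums_mult[OF Dy]])
  moreover have "logd ?z \<le> ?z * deriv (H 0) ?z"
    using D0 H1 mult_left_mono[OF H1 D0] by (simp add: logd_def divide_le_eq)
  ultimately show "logd ?z \<le> q ^ n * (y * deriv (H 0) y)" by simp
qed

text \<open>Along y, y q, y q^2, ... the differences of \<open>logd\<close> are the terms of the
  density series, and \<open>logd\<close> tends to 0.\<close>

lemma avg_density_eq_logd:
  assumes y: "0 \<le> y" "y < 1"
  shows "avg_density q \<mu> y = logd y"
proof -
  have "(\<lambda>n. q ^ n * (y * deriv (H 0) y)) \<longlonglongrightarrow> 0"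
    using q by (intro tendsto_mult_left_zero LIMSEQ_realpow_zero) auto
  then have "(\<lambda>n. logd (y * q ^ n)) \<longlonglongrightarrow> 0"
    by (rule tendsto_sandwich[rotated 3, where f = "\<lambda>_. 0"]) (use logd_bounds[OF y] in auto)
  then have "(\<lambda>n. logd (y * q ^ n) - logd (y * q ^ Suc n)) sums (logd (y * q ^ 0) - 0)"
    by (rule telescope_sums')
  also have "(\<lambda>n. logd (y * q ^ n) - logd (y * q ^ Suc n)) =
      (\<lambda>i. (1 - \<mu>) * y * q ^ i / ((1 - y * q ^ i) * (1 - \<mu> * y * q ^ i)))"
    using logd_step[OF yq_bounds[OF y]] by (simp add: fun_eq_iff mult_ac)
  finally show ?thesis by (simp add: avg_density_def sums_iff)
qed

section \<open>The Euler operator on the eigenvector and on the operators\<close>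

definition euler_eigvec :: "real \<Rightarrow> nat \<Rightarrow> real" where
  "euler_eigvec y m = y * deriv (\<lambda>y. eigvec y m) y"

lemma euler_eigvec_0 [simp]: "euler_eigvec y 0 = 0"
  by (simp add: euler_eigvec_def)

lemma eigvec_has_derivative:
  assumes "0 < y"
  shows "((\<lambda>y. eigvec y m) has_field_derivative deriv (\<lambda>y. eigvec y m) y) (at y)"
proof -
  have "(\<lambda>y. qpoch q (\<mu> * y) m) differentiable at y"
    by (induction m) (auto simp: qpoch_Suc)
  moreover have "qpoch q q m \<noteq> 0" using qpoch_pos[of q m] q by simp
  ultimately have "(\<lambda>y. eigvec y m) differentiable at y"
    unfolding eigvec_def using assms by (intro differentiable_divide) auto
  then show ?thesis by (simp add: DERIV_deriv_iff_real_differentiable)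
qed

text \<open>The matrix of \<open>\<theta> A\<^sub>a\<close>: only the factors
  \<open>H a (y * q ^ i)\<close> depend on y.\<close>

definition euler_mp_op :: "real \<Rightarrow> nat \<Rightarrow> (nat \<Rightarrow> real) \<Rightarrow> nat \<Rightarrow> real" where
  "euler_mp_op y a x m = (\<Sum>i\<le>m. (y * q ^ i * deriv (H a) (y * q ^ i)) *
     (cprod q (a + i) a * g (m - i)) * x (a + i))"

text \<open>In the logarithmic derivative, \<open>H 0 y\<close> contributes \<open>logd y\<close>
  and y^(-a) contributes -a. The latter is the origin of the particle numbers in the final
  result.\<close>

lemma eigval_has_derivative:
  assumes y: "0 < y" "y < 1"
  shows "((\<lambda>y. eigval y a) has_field_derivative ((logd y - real a) * eigval y a / y)) (at y)"
proof -
  have h: "0 < H 0 y" using y by (intro H_pos) auto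
  have p: "((\<lambda>y. inverse y ^ a) has_field_derivative (- (real a * inverse y ^ a / y))) (at y)"
  proof -
    have "(inverse has_field_derivative - (inverse y * inverse y)) (at y)"
      using DERIV_inverse[of y UNIV] y by (simp add: power2_eq_square)
    from DERIV_power[OF this, of a] show ?thesis
      using y by (cases a) (auto simp: divide_inverse mult_ac)
  qed
  have "((\<lambda>y. kap a 0 * inverse y ^ a * H 0 y) has_field_derivative
      kap a 0 * (- (real a * inverse y ^ a / y)) * H 0 y + deriv (H 0) y * (kap a 0 * inverse y ^ a)) (at y)"
    using y by (intro DERIV_mult DERIV_cmult p H_has_derivative(1)) auto
  also have "kap a 0 * (- (real a * inverse y ^ a / y)) * H 0 y + deriv (H 0) y * (kap a 0 * inverse y ^ a) =
      (logd y - real a) * eigval y a / y"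
    using y h by (simp add: logd_def eigval_def field_simps)
  also have "(\<lambda>y. kap a 0 * inverse y ^ a * H 0 y) = (\<lambda>y. eigval y a)"
    by (simp add: eigval_def power_inverse divide_inverse)
  finally show ?thesis .
qed

text \<open>The Euler operator \<open>y d/dy\<close> applied to the eigenvalue equation of \<open>A\<^sub>a\<close>.\<close>

lemma euler_mp_op_eigvec:
  assumes y: "0 < y" "y < 1"
  shows "euler_mp_op y a (eigvec y) m + mp_op y (MA a) (euler_eigvec y) m =
     (logd y - real a) * eigval y a * eigvec y m + eigval y a * euler_eigvec y m"
proof -
  define c where "c = (\<lambda>i. cprod q (a + i) a * g (m - i))"
  define v' where "v' = (\<lambda>m. deriv (\<lambda>y. eigvec y m) y)"
  have F: "mp_op t (MA a) x m = (\<Sum>i\<le>m. H a (t * q ^ i) * c i * x (a + i))" for t x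
    by (simp add: mp_op_altdef c_def)
  have v: "((\<lambda>t. eigvec t i) has_field_derivative v' i) (at y)" for i
    unfolding v'_def using y by (intro eigvec_has_derivative) auto
  have Hd: "((\<lambda>t. H a (t * q ^ i)) has_field_derivative deriv (H a) (y * q ^ i) * q ^ i) (at y)" for i
  proof (rule DERIV_chain2[where f = "H a" and g = "\<lambda>t. t * q ^ i"])
    show "(H a has_field_derivative deriv (H a) (y * q ^ i)) (at (y * q ^ i))"
      using yq_bounds[of y i] y by (intro H_has_derivative(1)) auto
  qed (auto intro!: derivative_eq_intros)
  have "((\<lambda>t. mp_op t (MA a) (eigvec t) m) has_field_derivative
      (\<Sum>i\<le>m. deriv (H a) (y * q ^ i) * q ^ i * c i * eigvec y (a + i) + H a (y * q ^ i) * c i * v' (a + i))) (at y)"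
    unfolding F by (auto intro!: derivative_eq_intros v Hd sum.cong)
  \<comment> \<open>The eigenvalue equation holds for all t in (0,1), so its sides have the same
    derivative at y.\<close>
  then have "((\<lambda>t. eigval t a * eigvec t m) has_field_derivative
      (\<Sum>i\<le>m. deriv (H a) (y * q ^ i) * q ^ i * c i * eigvec y (a + i) + H a (y * q ^ i) * c i * v' (a + i))) (at y)"
    by (rule has_field_derivative_transform_within_open[of _ _ _ "{0<..<1}"])
       (use y mp_op_eigvec in auto)
  moreover have "((\<lambda>t. eigval t a * eigvec t m) has_field_derivative
      ((logd y - real a) * eigval y a / y * eigvec y m + eigval y a * v' m)) (at y)"
    using y by (auto intro!: derivative_eq_intros eigval_has_derivative v)
  ultimately have "(\<Sum>i\<le>m. deriv (H a) (y * q ^ i) * q ^ i * c i * eigvec y (a + i) + H a (y * q ^ i) * c i * v' (a + i)) =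
      (logd y - real a) * eigval y a / y * eigvec y m + eigval y a * v' m"
    by (rule DERIV_unique)
  then have "y * (\<Sum>i\<le>m. deriv (H a) (y * q ^ i) * q ^ i * c i * eigvec y (a + i) + H a (y * q ^ i) * c i * v' (a + i)) =
      y * ((logd y - real a) * eigval y a / y * eigvec y m + eigval y a * v' m)"
    by (rule arg_cong)
  moreover have "y * (\<Sum>i\<le>m. deriv (H a) (y * q ^ i) * q ^ i * c i * eigvec y (a + i) + H a (y * q ^ i) * c i * v' (a + i)) =
      euler_mp_op y a (eigvec y) m + mp_op y (MA a) (euler_eigvec y) m"
    unfolding F euler_mp_op_def euler_eigvec_def v'_def[symmetric] c_def[symmetric] sum_distrib_left
      sum.distrib[symmetric]
    by (rule sum.cong) (auto simp: c_def v'_def algebra_simps)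
  moreover have "y * ((logd y - real a) * eigval y a / y * eigvec y m + eigval y a * v' m) =
      (logd y - real a) * eigval y a * eigvec y m + eigval y a * euler_eigvec y m"
    using y by (simp add: euler_eigvec_def v'_def distrib_left mult_ac)
  ultimately show ?thesis by simp
qed

text \<open>Weighting the power y^n by n is the action of y d/dy on the series for
  \<open>MA a\<close>; this is how mean occupation numbers become derivatives.\<close>

lemma mp_op_MX_sums:
  assumes y: "0 < y" "y < 1"
  shows "(\<lambda>n. real n * y ^ n * mp_op y (MX a n) x m) sums euler_mp_op y a x m"
proof -
  have "(\<lambda>n. \<Sum>i\<le>m. real n * (kap a n * (y * q ^ i) ^ n) * (cprod q (a + i) a * g (m - i)) * x (a + i)) sums
      euler_mp_op y a x m"
    unfolding euler_mp_op_def
  proof (intro sums_sum sums_mult2 H_has_derivative(2))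
    show "\<bar>y * q ^ i\<bar> < 1" for i
      using yq_bounds[of y i] y by simp
  qed
  also have "(\<lambda>n. \<Sum>i\<le>m. real n * (kap a n * (y * q ^ i) ^ n) * (cprod q (a + i) a * g (m - i)) * x (a + i)) =
      (\<lambda>n. real n * y ^ n * mp_op y (MX a n) x m)"
    unfolding mp_op_altdef sum_distrib_left
    by (rule ext, rule sum.cong) (auto simp: power_mult_distrib mult_ac simp flip: power_mult)
  finally show ?thesis .
qed

lemma mp_op_sums:
  "(\<And>m. (\<lambda>n. f n m) sums F m) \<Longrightarrow> (\<lambda>n. mp_op y w (f n) m) sums mp_op y w F m"
  unfolding mp_op_def by (intro sums_sum sums_mult)

lemma foldr_mp_op_sums:
  "(\<And>m. (\<lambda>n. f n m) sums F m) \<Longrightarrow> (\<lambda>n. foldr (mp_op y) U (f n) m) sums foldr (mp_op y) U F m"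
  by (induction U arbitrary: m) (auto intro: mp_op_sums)

section \<open>Limiting probabilities and their means\<close>

abbreviation eigprod :: "real \<Rightarrow> nat list \<Rightarrow> real" where
  "eigprod y as \<equiv> prod_list (map (eigval y) as)"

lemma eigprod_pos: "0 < y \<Longrightarrow> y < 1 \<Longrightarrow> 0 < eigprod y as"
  by (induction as) (auto intro: mult_pos_pos eigval_pos)

text \<open>Only the sites to the left of the observed one appear: those to its right act on the
  eigenvector, and their eigenvalues cancel against the normalisation.\<close>

definition prob :: "real \<Rightarrow> nat list \<Rightarrow> nat \<Rightarrow> nat \<Rightarrow> real" where
  "prob y as a n = y ^ n * foldr (mp_op y) (map MA as) (mp_op y (MX a n) (eigvec y)) 0 / eigprod y (as @ [a])"

text \<open>The quantity \<open>e\<^sub>r\<close>, for the list of occupation numbers of the first r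
  sites.\<close>

definition excess :: "real \<Rightarrow> nat list \<Rightarrow> real" where
  "excess y as = foldr (mp_op y) (map MA as) (euler_eigvec y) 0 / eigprod y as"

text \<open>Summation over n produces \<open>\<theta> A\<^sub>a\<close>, which
  \<open>euler_mp_op_eigvec\<close> trades for eigenvalue terms and a term with \<open>MA a\<close>
  applied to \<open>euler_eigvec\<close>. In the latter the site joins the word on its left, which
  gives the second \<open>excess\<close>.\<close>

lemma density_sums:
  assumes y: "0 < y" "y < 1"
  shows "(\<lambda>n. real n * prob y as a n) sums (logd y - real a + excess y as - excess y (as @ [a]))"
proof -
  let ?U = "map MA as" and ?v = "eigvec y" and ?v' = "euler_eigvec y"
  have P: "0 < eigprod y as" "0 < eigval y a" using y by (auto intro: eigprod_pos eigval_pos)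
  have "(\<lambda>n. foldr (mp_op y) ?U (\<lambda>m. real n * y ^ n * mp_op y (MX a n) ?v m) 0) sums
      foldr (mp_op y) ?U (euler_mp_op y a ?v) 0"
    by (intro foldr_mp_op_sums mp_op_MX_sums y)
  then have "(\<lambda>n. real n * y ^ n * foldr (mp_op y) ?U (mp_op y (MX a n) ?v) 0 / eigprod y (as @ [a])) sums
      (foldr (mp_op y) ?U (euler_mp_op y a ?v) 0 / eigprod y (as @ [a]))"
    unfolding foldr_mp_op_scale by (rule sums_divide)
  also have "(\<lambda>n. real n * y ^ n * foldr (mp_op y) ?U (mp_op y (MX a n) ?v) 0 / eigprod y (as @ [a])) =
      (\<lambda>n. real n * prob y as a n)"
    by (simp add: prob_def mult.assoc)
  also have "foldr (mp_op y) ?U (euler_mp_op y a ?v) 0 / eigprod y (as @ [a]) =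
      logd y - real a + excess y as - excess y (as @ [a])"
  proof -
    have "euler_mp_op y a ?v = (\<lambda>m. (logd y - real a) * eigval y a * ?v m + 1 *
        (eigval y a * ?v' m + (- 1) * mp_op y (MA a) ?v' m))"
      using euler_mp_op_eigvec[OF y, of a] by (auto simp: fun_eq_iff algebra_simps)
    then have "foldr (mp_op y) ?U (euler_mp_op y a ?v) 0 =
        (logd y - real a) * eigval y a * foldr (mp_op y) ?U ?v 0 + 1 *
        (eigval y a * foldr (mp_op y) ?U ?v' 0 + (- 1) * foldr (mp_op y) ?U (mp_op y (MA a) ?v') 0)"
      by (simp only: foldr_mp_op_lincomb)
    moreover have "((u - k) * l * W + 1 * (l * p + (- 1) * M)) / (W * l) = u - k + p / W - M / (W * l)"
      if "0 < W" "0 < l" for u k l W p M :: real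
      using that by (simp add: field_simps)
    ultimately show ?thesis
      using P by (simp add: foldr_mp_op_eigvec[OF y] excess_def)
  qed
  finally show ?thesis .
qed

text \<open>The block acts on \<open>euler_eigvec\<close>, whose vacuum component is 0 because
  \<open>eigvec y 0\<close> is constant in y. By the gap it grows more slowly than the
  normalisation.\<close>

lemma excess_geo:
  assumes y: "0 < y" "y < 1"
  shows "\<exists>C b. 0 \<le> b \<and> b < 1 \<and> (\<forall>n. \<bar>excess y (ds @ replicate n 0)\<bar> \<le> C * b ^ n)"
proof -
  obtain \<tau> where \<tau>: "0 < \<tau>" "\<tau> < 1" "H 0 (q * y) * H 0 \<tau> < H 0 y" using exists_gap[OF y] by blast
  define b where "b = H 0 (q * y) * H 0 \<tau>"
  have qy: "0 \<le> q * y" "q * y < 1" using yq_bounds[of y 1] y by (auto simp: mult.commute)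
  have b: "0 \<le> b" "b < H 0 y" using \<tau> qy less_imp_le[OF H_pos] by (auto simp: b_def)
  have P: "0 < eigprod y ds" using y by (rule eigprod_pos)
  have "geo_bounded b (\<lambda>n. foldr (mp_op y) (map MA ds) (foldr (mp_op y) (vac n) (euler_eigvec y)))"
    unfolding b_def by (intro geo_bounded_foldr geo_bounded_vac y \<tau>) simp
  then obtain C where C: "\<And>n. \<bar>foldr (mp_op y) (map MA ds) (foldr (mp_op y) (vac n) (euler_eigvec y)) 0\<bar> \<le> C * b ^ n"
    unfolding geo_bounded_def by blast
  have "\<bar>excess y (ds @ replicate n 0)\<bar> \<le> C / eigprod y ds * (b / H 0 y) ^ n" for n
  proof -
    have "\<bar>excess y (ds @ replicate n 0)\<bar> =
        \<bar>foldr (mp_op y) (map MA ds) (foldr (mp_op y) (vac n) (euler_eigvec y)) 0\<bar> / (eigprod y ds * H 0 y ^ n)"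
      using P b by (simp add: excess_def eigval_0 abs_mult)
    also have "\<dots> \<le> C * b ^ n / (eigprod y ds * H 0 y ^ n)"
      using P b by (intro divide_right_mono C) auto
    finally show ?thesis by (simp add: power_divide)
  qed
  moreover have "0 \<le> b / H 0 y" "b / H 0 y < 1" using b by auto
  ultimately show ?thesis by blast
qed

text \<open>One statement for all three regions. Here p counts the empty sites that the numerator
  word lists explicitly in addition to those of \<open>ds\<close>; the shorter block behind it is
  compensated by h^p.\<close>

lemma prob_tendsto:
  assumes y: "0 < y" "y < 1"
    and len: "length (as @ a # bs) = length ds + p"
    and prd: "eigprod y (as @ a # bs) = H 0 y ^ p * eigprod y ds"
  shows "(\<lambda>L. inverse (mp_trace q \<mu> y (map MA ds @ vac (L - length ds))) * complex_of_real y ^ n *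
     mp_trace q \<mu> y (map MA as @ [MX a n] @ map MA bs @ vac (L - length (as @ a # bs))))
     \<longlonglongrightarrow> complex_of_real (prob y as a n)"
proof -
  define h where "h = H 0 y"
  have h: "h > 0" using y by (auto simp: h_def intro: H_pos)
  let ?U = "map MA as @ [MX a n] @ map MA bs"
  let ?k = "length (as @ a # bs)"
  define T1 where "T1 = (\<lambda>L. mp_trace q \<mu> y (map MA ds @ vac L) / complex_of_real (h ^ L))"
  define T2 where "T2 = (\<lambda>L. mp_trace q \<mu> y (?U @ vac L) / complex_of_real (h ^ L))"
  define F where "F = foldr (mp_op y) (map MA as) (mp_op y (MX a n) (eigvec y)) 0"
  have P: "0 < eigprod y ds" "0 < eigprod y as" "0 < eigprod y bs" "0 < eigval y a"
    using y by (auto intro: eigprod_pos eigval_pos)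
  have l1: "T1 \<longlonglongrightarrow> complex_of_real (eigprod y ds)"
    using mp_trace_tendsto[OF y, of "map MA ds"] by (simp add: T1_def h_def foldr_mp_op_eigvec[OF y])
  have "foldr (mp_op y) ?U (eigvec y) 0 = eigprod y bs * F"
  proof -
    have "foldr (mp_op y) (map MA bs) (eigvec y) = (\<lambda>m. eigprod y bs * eigvec y m)"
      by (rule ext) (rule foldr_mp_op_eigvec[OF y])
    moreover have "mp_op y (MX a n) (\<lambda>m. eigprod y bs * eigvec y m) =
        (\<lambda>m. eigprod y bs * mp_op y (MX a n) (eigvec y) m)"
      using foldr_mp_op_scale[of y "[MX a n]"] by auto
    ultimately show ?thesis by (simp add: F_def foldr_mp_op_scale)
  qed
  then have l2: "T2 \<longlonglongrightarrow> complex_of_real (eigprod y bs * F)"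
    using mp_trace_tendsto[OF y, of ?U] unfolding T2_def h_def by simp
  have "(\<lambda>L. inverse (T1 (L - length ds)) * complex_of_real y ^ n * T2 (L - ?k) / complex_of_real (h ^ p)) \<longlonglongrightarrow>
      inverse (complex_of_real (eigprod y ds)) * complex_of_real y ^ n * complex_of_real (eigprod y bs * F) / complex_of_real (h ^ p)"
    by (intro tendsto_intros filterlim_compose[OF l1] filterlim_compose[OF l2] filterlim_minus_const_nat_at_top)
       (use P h in auto)
  moreover have "\<forall>\<^sub>F L in sequentially.
      inverse (T1 (L - length ds)) * complex_of_real y ^ n * T2 (L - ?k) / complex_of_real (h ^ p) =
      inverse (mp_trace q \<mu> y (map MA ds @ vac (L - length ds))) * complex_of_real y ^ n *
        mp_trace q \<mu> y (map MA as @ [MX a n] @ map MA bs @ vac (L - ?k))"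
    using eventually_ge_at_top[of ?k]
  proof eventually_elim
    case (elim L)
    then have "L - length ds = (L - ?k) + p" using len by simp
    then have hc: "complex_of_real h ^ (L - length ds) = complex_of_real h ^ (L - ?k) * complex_of_real h ^ p"
      by (simp add: power_add)
    \<comment> \<open>X is the normalising trace, which is not excluded from being 0; since
      \<open>inverse 0 = 0\<close>, the identity holds then as well.\<close>
    have *: "inverse (X / (A * B)) * c * (Y / A) / B = inverse X * c * Y" if "A \<noteq> 0" "B \<noteq> 0" for A B c X Y :: complex
      using that by (cases "X = 0") (auto simp: field_simps)
    show ?case unfolding T1_def T2_def of_real_power hc append_assoc by (rule *) (use h in auto)
  qed
  moreover have "inverse (complex_of_real (eigprod y ds)) * complex_of_real y ^ n * complex_of_real (eigprod y bs * F) / complex_of_real (h ^ p) =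
      complex_of_real (prob y as a n)"
  proof -
    have "y ^ n * (eigprod y bs * F) / (h ^ p * eigprod y ds) = prob y as a n"
      unfolding h_def prd[symmetric] using P by (simp add: prob_def F_def)
    then show ?thesis by (simp add: field_simps flip: of_real_power of_real_mult of_real_inverse of_real_divide)
  qed
  ultimately show ?thesis by (simp only: Lim_transform_eventually)
qed

end

context q_mu
begin

section \<open>Local densities in the three regions and their sum\<close>

lemma density_complex:
  assumes y: "0 < y" "y < 1" and P: "\<And>n. P n = complex_of_real (prob y as a n)"
  shows "(\<Sum>n. of_nat n * P n) - complex_of_real (avg_density q \<mu> y) =
     complex_of_real (excess y as - excess y (as @ [a]) - real a)"
proof -
  have "(\<lambda>n. complex_of_real (real n * prob y as a n)) sums
      complex_of_real (logd y - real a + excess y as - excess y (as @ [a]))"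
    by (intro sums_of_real density_sums y)
  then have "(\<Sum>n. of_nat n * P n) = complex_of_real (logd y - real a + excess y as - excess y (as @ [a]))"
    by (simp add: P sums_iff)
  then show ?thesis using y by (simp add: avg_density_eq_logd)
qed

lemma A_word_eq: "A_word d i j = map MA (map d [i..<Suc j])"
  by (simp add: A_word_def)

lemma excess_Nil [simp]: "excess y [] = 0"
  by (simp add: excess_def)

lemma upt_split: "1 \<le> r \<Longrightarrow> r \<le> s \<Longrightarrow> [1..<Suc s] = [1..<r] @ r # [r + 1..<Suc s]"
  using upt_add_eq_append[of 1 r "Suc s - r"] by (simp add: upt_conv_Cons del: upt_Suc)

lemma rho_I_excess:
  assumes y: "0 < y" "y < 1" and r: "1 \<le> r" "r \<le> s"
  shows "rho_I q \<mu> y s d r - complex_of_real (avg_density q \<mu> y) =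
     complex_of_real (excess y (map d [1..<r]) - excess y (map d [1..<Suc r]) - real (d r))"
proof -
  let ?ds = "map d [1..<Suc s]" and ?as = "map d [1..<r]" and ?bs = "map d [r + 1..<Suc s]"
  have ds: "?ds = ?as @ d r # ?bs" unfolding upt_split[OF r] by simp
  have len: "length (?as @ d r # ?bs) = s" unfolding ds[symmetric] by simp
  have "P_I q \<mu> y s d r n = complex_of_real (prob y ?as (d r) n)" for n
  proof -
    have "(\<lambda>L. inverse (mp_trace q \<mu> y (map MA ?ds @ vac (L - length ?ds))) * complex_of_real y ^ n *
        mp_trace q \<mu> y (map MA ?as @ [MX (d r) n] @ map MA ?bs @ vac (L - length (?as @ d r # ?bs))))
        \<longlonglongrightarrow> complex_of_real (prob y ?as (d r) n)"
      by (rule prob_tendsto[OF y, where p = 0]) (simp_all only: ds[symmetric], simp_all)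
    then show ?thesis
      unfolding P_I_def Z_part_def A_word_eq len using r by (intro limI) (simp del: upt_Suc)
  qed
  then have "rho_I q \<mu> y s d r - complex_of_real (avg_density q \<mu> y) =
      complex_of_real (excess y ?as - excess y (?as @ [d r]) - real (d r))"
    unfolding rho_I_def by (rule density_complex[OF y])
  then show ?thesis using r by simp
qed

lemma rho_II_excess:
  assumes y: "0 < y" "y < 1"
  shows "rho_II q \<mu> y s d (Suc (s + k)) - complex_of_real (avg_density q \<mu> y) =
     complex_of_real (excess y (map d [1..<Suc s] @ replicate k 0) -
       excess y (map d [1..<Suc s] @ replicate (Suc k) 0))"
proof -
  let ?ds = "map d [1..<Suc s]"
  let ?as = "?ds @ replicate k 0"
  have len: "length (?as @ 0 # []) = Suc (s + k)" by simp
  have "P_II q \<mu> y s d (Suc (s + k)) n = complex_of_real (prob y ?as 0 n)" for n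
  proof -
    have "(\<lambda>L. inverse (mp_trace q \<mu> y (map MA ?ds @ vac (L - length ?ds))) * complex_of_real y ^ n *
        mp_trace q \<mu> y (map MA ?as @ [MX 0 n] @ map MA [] @ vac (L - length (?as @ 0 # []))))
        \<longlonglongrightarrow> complex_of_real (prob y ?as 0 n)"
      \<comment> \<open>The k empty sites in between and the observed site itself.\<close>
      by (rule prob_tendsto[OF y, where p = "Suc k"]) (simp_all add: eigval_0 mult_ac)
    then show ?thesis
      unfolding P_II_def Z_part_def A_word_eq len by (intro limI) (simp del: upt_Suc)
  qed
  then have "rho_II q \<mu> y s d (Suc (s + k)) - complex_of_real (avg_density q \<mu> y) =
      complex_of_real (excess y ?as - excess y (?as @ [0]) - real 0)"
    unfolding rho_II_def by (rule density_complex[OF y])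
  then show ?thesis by (simp add: replicate_append_same)
qed

text \<open>No operator stands to the left of the observed site, so only the excesses of the empty
  word and of one empty site occur. Both are 0, since \<open>MA 0\<close> is lower triangular and
  \<open>euler_eigvec\<close> has no vacuum component.\<close>

lemma rho_III_excess:
  assumes y: "0 < y" "y < 1"
  shows "rho_III q \<mu> y s d r = complex_of_real (avg_density q \<mu> y)"
proof -
  let ?ds = "map d [1..<Suc s]" and ?k = "nat \<bar>r\<bar>"
  let ?bs = "replicate ?k 0 @ ?ds"
  have "P_III q \<mu> y s d r n = complex_of_real (prob y [] 0 n)" for n
  proof -
    have "(\<lambda>L. inverse (mp_trace q \<mu> y (map MA ?ds @ vac (L - length ?ds))) * complex_of_real y ^ n *
        mp_trace q \<mu> y (map MA [] @ [MX 0 n] @ map MA ?bs @ vac (L - length ([] @ 0 # ?bs))))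
        \<longlonglongrightarrow> complex_of_real (prob y [] 0 n)"
      by (rule prob_tendsto[OF y, where p = "Suc ?k"]) (simp_all add: eigval_0 mult_ac)
    moreover have "L - length ([] @ 0 # ?bs) = L - ?k - s - 1" for L by (simp del: upt_Suc)
    ultimately show ?thesis
      unfolding P_III_def Z_part_def A_word_eq by (intro limI) (simp del: upt_Suc)
  qed
  then have "rho_III q \<mu> y s d r - complex_of_real (avg_density q \<mu> y) =
      complex_of_real (excess y [] - excess y ([] @ [0]) - real 0)"
    unfolding rho_III_def by (rule density_complex[OF y])
  moreover have "excess y [0] = 0" by (simp add: excess_def mp_op_MA_0)
  ultimately show ?thesis by simp
qed

text \<open>The terms are differences of a geometrically decaying sequence. The decay gives the
  absolute convergence that an unordered sum requires, and telescoping leaves the excess after site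
  s.\<close>

lemma rho_II_has_sum:
  assumes y: "0 < y" "y < 1"
  shows "((\<lambda>r. rho_II q \<mu> y s d r - complex_of_real (avg_density q \<mu> y)) has_sum
     complex_of_real (excess y (map d [1..<Suc s]))) {s<..}"
proof -
  define u where "u = (\<lambda>k. excess y (map d [1..<Suc s] @ replicate k 0))"
  define f where "f = (\<lambda>r. rho_II q \<mu> y s d r - complex_of_real (avg_density q \<mu> y))"
  have f: "f (Suc (s + k)) = complex_of_real (u k - u (Suc k))" for k
    unfolding f_def u_def by (rule rho_II_excess[OF y])
  obtain C b where b: "0 \<le> b" "b < 1" and C: "\<And>k. \<bar>u k\<bar> \<le> C * b ^ k"
    using excess_geo[OF y] unfolding u_def by blast
  have bs: "summable (\<lambda>k. C * b ^ k + C * b ^ Suc k)"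
    using b by (intro summable_add summable_mult summable_geometric
        summable_Suc_iff[of "\<lambda>k. C * b ^ k", THEN iffD2]) auto
  have sn: "summable (\<lambda>k. norm (f (Suc (s + k))))"
  proof (rule summable_comparison_test'[OF bs])
    fix k
    show "norm (norm (f (Suc (s + k)))) \<le> C * b ^ k + C * b ^ Suc k"
      using C[of k] C[of "Suc k"] unfolding f norm_of_real by simp
  qed
  have "(\<lambda>k. C * b ^ k) \<longlonglongrightarrow> 0"
    using b by (intro tendsto_mult_right_zero LIMSEQ_realpow_zero) auto
  then have "u \<longlonglongrightarrow> 0"
    by (rule Lim_null_comparison[rotated]) (use C in auto)
  then have "(\<lambda>k. u k - u (Suc k)) sums (u 0 - 0)" by (rule telescope_sums')
  then have "(\<lambda>k. f (Suc (s + k))) sums complex_of_real (u 0)"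
    unfolding f by (intro sums_of_real) simp
  then have "((\<lambda>k. f (Suc (s + k))) has_sum complex_of_real (u 0)) UNIV"
    by (rule norm_summable_imp_has_sum[OF sn])
  also have "(\<lambda>k. f (Suc (s + k))) = f \<circ> (\<lambda>k. Suc (s + k))" by auto
  also have "(\<dots> has_sum complex_of_real (u 0)) UNIV \<longleftrightarrow>
      (f has_sum complex_of_real (u 0)) (range (\<lambda>k. Suc (s + k)))"
    by (rule has_sum_reindex[symmetric]) (auto simp: inj_on_def)
  also have "range (\<lambda>k. Suc (s + k)) = {s<..}"
    by (auto simp: image_iff less_iff_Suc_add)
  finally show ?thesis by (simp add: f_def u_def)
qed

lemma local_density_has_sum:
  assumes y: "0 < y" "y < 1"
  shows "((\<lambda>r. local_density q \<mu> y s d r - complex_of_real (avg_density q \<mu> y)) has_sum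
     ((\<Sum>r=1..s. rho_I q \<mu> y s d r - complex_of_real (avg_density q \<mu> y)) +
      complex_of_real (excess y (map d [1..<Suc s])))) UNIV"
proof -
  let ?\<rho> = "complex_of_real (avg_density q \<mu> y)"
  define f where "f = (\<lambda>r. local_density q \<mu> y s d r - ?\<rho>)"
  have "(f has_sum 0) {..0}"
    by (rule has_sum_0) (auto simp: f_def local_density_def rho_III_excess[OF y])
  moreover have "(f has_sum (\<Sum>r=1..s. rho_I q \<mu> y s d r - ?\<rho>)) (int ` {1..s})"
  proof -
    have "((\<lambda>r. rho_I q \<mu> y s d r - ?\<rho>) has_sum (\<Sum>r=1..s. rho_I q \<mu> y s d r - ?\<rho>)) {1..s}"
      by (rule has_sum_finite) simp
    also have "?this \<longleftrightarrow> (f \<circ> int has_sum (\<Sum>r=1..s. rho_I q \<mu> y s d r - ?\<rho>)) {1..s}"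
      by (rule has_sum_cong) (auto simp: f_def local_density_def)
    finally show ?thesis by (subst has_sum_reindex) auto
  qed
  moreover have "(f has_sum complex_of_real (excess y (map d [1..<Suc s]))) (int ` {s<..})"
  proof -
    have "?thesis \<longleftrightarrow> (f \<circ> int has_sum complex_of_real (excess y (map d [1..<Suc s]))) {s<..}"
      by (rule has_sum_reindex) auto
    also have "\<dots> \<longleftrightarrow> ((\<lambda>r. rho_II q \<mu> y s d r - ?\<rho>) has_sum
        complex_of_real (excess y (map d [1..<Suc s]))) {s<..}"
      by (rule has_sum_cong) (auto simp: f_def local_density_def)
    finally show ?thesis using rho_II_has_sum[OF y] by simp
  qed
  ultimately have "(f has_sum (0 + (\<Sum>r=1..s. rho_I q \<mu> y s d r - ?\<rho>) +
      complex_of_real (excess y (map d [1..<Suc s])))) ({..0} \<union> int ` {1..s} \<union> int ` {s<..})"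
    by (intro has_sum_Un_disjoint) auto
  moreover have "{..0} \<union> int ` {1..s} \<union> int ` {s<..} = UNIV"
  proof -
    have "r \<in> {..0} \<union> int ` {1..s} \<union> int ` {s<..}" for r
    proof (cases "r \<le> 0")
      case False
      then have "r = int (nat r)" "1 \<le> nat r" by auto
      then show ?thesis by (metis UnCI atLeastAtMost_iff greaterThan_iff image_eqI not_less)
    qed auto
    then show ?thesis by blast
  qed
  ultimately show ?thesis by (simp add: f_def)
qed

text \<open>Telescoping over the sites 1 to s starts at the excess 0 of the empty word and leaves
  minus the excess after site s. This cancels the contribution of the sites beyond s, and only the
  -a of each site remains.\<close>

lemma sum_rho_I:
  assumes y: "0 < y" "y < 1"
  shows "(\<Sum>r=1..s. rho_I q \<mu> y s d r - complex_of_real (avg_density q \<mu> y)) +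
      complex_of_real (excess y (map d [1..<Suc s])) = - of_nat (\<Sum>i=1..s. d i)"
proof -
  define E where "E = (\<lambda>r. excess y (map d [1..<r]))"
  have "(\<Sum>r=1..s. rho_I q \<mu> y s d r - complex_of_real (avg_density q \<mu> y)) =
      (\<Sum>r=1..s. complex_of_real (E r - E (Suc r) - real (d r)))"
    unfolding E_def by (intro sum.cong rho_I_excess y) auto
  also have "\<dots> = complex_of_real ((\<Sum>r=1..s. E r - E (Suc r)) - (\<Sum>r=1..s. real (d r)))"
    by (simp add: sum_subtractf)
  also have "(\<Sum>r=1..s. E r - E (Suc r)) = E 1 - E (Suc s)"
    by (induction s) auto
  finally show ?thesis by (simp add: E_def)
qed

end

theorem proposition10:
  fixes q \<mu> y :: real and s :: nat and d :: "nat \<Rightarrow> nat"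
  assumes "0 < q" "q < 1" "0 < \<mu>" "\<mu> < 1" "0 < y" "y < 1"
    and "s \<ge> 1" and "d 1 \<ge> 1" and "d s \<ge> 1"
  shows "(\<lambda>r::int. local_density q \<mu> y s d r - complex_of_real (avg_density q \<mu> y)) summable_on UNIV \<and>
         total_excess q \<mu> y s d =
           (\<Sum>r=1..s. rho_I q \<mu> y s d r - complex_of_real (avg_density q \<mu> y)) +
           (\<Sum>\<^sub>\<infinity>r\<in>{s<..}. rho_II q \<mu> y s d r - complex_of_real (avg_density q \<mu> y)) \<and>
         total_excess q \<mu> y s d = - of_nat (\<Sum>i=1..s. d i)"
proof -
  interpret q_mu q \<mu>
    using assms by unfold_locales
  note y = \<open>0 < y\<close> \<open>y < 1\<close>
  note total = local_density_has_sum[OF y, of s d]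
  have "total_excess q \<mu> y s d = (\<Sum>r=1..s. rho_I q \<mu> y s d r - complex_of_real (avg_density q \<mu> y)) +
      complex_of_real (excess y (map d [1..<Suc s]))"
    unfolding total_excess_def using total by (rule infsumI)
  moreover have "(\<Sum>\<^sub>\<infinity>r\<in>{s<..}. rho_II q \<mu> y s d r - complex_of_real (avg_density q \<mu> y)) =
      complex_of_real (excess y (map d [1..<Suc s]))"
    using rho_II_has_sum[OF y] by (rule infsumI)
  ultimately show ?thesis
    using has_sum_imp_summable[OF total] sum_rho_I[OF y, of s d] by simp
qed

end
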